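(* Let $H\in(1/4,1/2)$, $T>0$, and let $\gamma\in(0,1)$ with $\gamma+H<1$. Then the couple $(Y,Y')=(W^H,1)$ belongs almost surely to $\mathscr{D}_{\widehat W^H}^{\gamma+H,H^-}((0,T])$; that is, for every $\eta<H$, almost surely $$\sup_{0<s<t\le T}\frac{\big|W^H_t-W^H_s-(\widehat W^H_t-\widehat W^H_s)\big|}{s^{\eta-(\gamma+H)}|t-s|^{\gamma+H}}<\infty .$$
   Context: $W$ is a standard two-sided real Brownian motion. $K^H(u)=u^{H-1/2}\mathbf 1_{u>0}$ and $W^H_t=\int_0^tK^H(t-s)\,dW_s$. $\widehat K^H:\mathbb{R}\setminus\{0\}\to\mathbb{R}_+$ is a fixed smooth function with (1) $\widehat K^H=K^H$ on $(0,T]$ and $\mathrm{supp}(\widehat K^H)\subset[0,2T]$; (2) there is $C>0$ with $|\partial^k\widehat K^H(u)|\le C|\partial^kK^H(u)|$ for $k=0,1,2$. The stationary process is $\widehat W^H_t=\int_{-\infty}^t\widehat K^H(t-s)\,dW_s$. The space $\mathscr{D}_{\hat X}^{\gamma+\beta,\eta}((0,T])$ of singular controlled rough paths consists of pairs $(Y,Y')$ such that, with $R^Y_{s,t}:=Y_t-Y_s-Y'_s(\hat X_t-\hat X_s)$, $$\sup_{0<s<t\le T}\frac{|Y'_t-Y'_s|}{s^{\eta-(\gamma+\beta)}|t-s|^\gamma}+\sup_{0<s<t\le T}\frac{|R^Y_{s,t}|}{s^{\eta-(\gamma+\beta)}|t-s|^{\gamma+\beta}}<\infty .$$ Here $\hat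 X=\widehat W^H$, the exponent $\gamma+\beta$ is $\gamma+H$, and $H^-$ means any value $\eta<H$; since $Y'\equiv1$ the first term vanishes. Almost sure statements are for continuous versions of the processes. *)

theory Defs
  imports "HOL-Probability.Probability"
begin

text \<open>Standard two-sided Brownian motion, indexed by the whole real line and normalised by
  \<open>W 0 = 0\<close>. The second parameter of \<^const>\<open>normal_density\<close> is the standard deviation, hence
  the square root.\<close>

locale two_sided_brownian_motion = prob_space M for M :: "'a measure" +
  fixes W :: "real \<Rightarrow> 'a \<Rightarrow> real"
  assumes random_variable_W: "\<And>t. random_variable borel (W t)"
    and W_zero: "AE \<omega> in M. W 0 \<omega> = 0"
    and normal_increments:
      "\<And>s t. s < t \<Longrightarrow>
         distributed M lborel (\<lambda>\<omega>. W t \<omega> - W s \<omega>) (normal_density 0 (sqrt (t - s)))"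
    and indep_increments:
      "\<And>(n::nat) (\<tau>::nat \<Rightarrow> real). (\<And>i. i < n \<Longrightarrow> \<tau> i < \<tau> (Suc i)) \<Longrightarrow>
         indep_vars (\<lambda>_. borel) (\<lambda>i \<omega>. W (\<tau> (Suc i)) \<omega> - W (\<tau> i) \<omega>) {..<n}"
    and continuous_paths: "AE \<omega> in M. continuous_on UNIV (\<lambda>t. W t \<omega>)"

text \<open>A list of triples \<open>(c, a, b)\<close> with \<open>a \<le> b\<close> represents the step function that is the sum of
  the \<open>c \<cdot> 1\<^bsub>(a,b]\<^esub>\<close>.\<close>

definition step_rep :: "(real \<times> real \<times> real) list \<Rightarrow> bool" where
  "step_rep p \<longleftrightarrow> (\<forall>(c, a, b) \<in> set p. a \<le> b)"

definition step_fun :: "(real \<times> real \<times> real) list \<Rightarrow> real \<Rightarrow> real" where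
  "step_fun p u = (\<Sum>(c, a, b)\<leftarrow>p. c * indicator {a<..b} u)"

definition step_integral ::
    "(real \<Rightarrow> 'a \<Rightarrow> real) \<Rightarrow> (real \<times> real \<times> real) list \<Rightarrow> 'a \<Rightarrow> real" where
  "step_integral W p \<omega> = (\<Sum>(c, a, b)\<leftarrow>p. c * (W b \<omega> - W a \<omega>))"

text \<open>\<open>X\<close> is (a version of) the Wiener integral of the deterministic function \<open>f\<close> over \<open>A\<close> with
  respect to \<open>W\<close>, i.e. the \<open>L\<^sup>2(M)\<close>-limit of the integrals of step functions converging to
  \<open>1\<^sub>A f\<close> in \<open>L\<^sup>2(\<real>)\<close>. For a Brownian motion \<open>W\<close> it is almost surely unique by the Ito isometry.
  Nonnegative integrals are used so that convergence to \<open>0\<close> cannot hold for lack of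
  integrability.\<close>

definition has_wiener_integral ::
    "'a measure \<Rightarrow> (real \<Rightarrow> 'a \<Rightarrow> real) \<Rightarrow> real set \<Rightarrow> (real \<Rightarrow> real) \<Rightarrow> ('a \<Rightarrow> real) \<Rightarrow> bool" where
  "has_wiener_integral M W A f X \<longleftrightarrow>
     (\<lambda>u. indicator A u * f u) \<in> borel_measurable lborel \<and>
     integrable lborel (\<lambda>u. (indicator A u * f u)\<^sup>2) \<and>
     X \<in> borel_measurable M \<and>
     (\<exists>p. (\<forall>n. step_rep (p n)) \<and>
        (\<lambda>n. \<integral>\<^sup>+ u. ennreal ((indicator A u * f u - step_fun (p n) u)\<^sup>2) \<partial>lborel) \<longlonglongrightarrow> 0 \<and>
        (\<lambda>n. \<integral>\<^sup>+ \<omega>. ennreal ((X \<omega> - step_integral W (p n) \<omega>)\<^sup>2) \<partial>M) \<longlonglongrightarrow> 0)"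

definition rl_kernel :: "real \<Rightarrow> real \<Rightarrow> real" where
  "rl_kernel H u = (if u > 0 then u powr (H - 1/2) else 0)"

text \<open>The modified kernel is a function on \<open>\<real> - {0}\<close>; its value at \<open>0\<close> is left unconstrained.\<close>

definition modified_kernel :: "real \<Rightarrow> real \<Rightarrow> (real \<Rightarrow> real) \<Rightarrow> bool" where
  "modified_kernel H T K \<longleftrightarrow>
     (\<forall>u. u \<noteq> 0 \<longrightarrow> K u \<ge> 0) \<and>
     (\<forall>k. (deriv ^^ k) K differentiable_on - {0}) \<and>
     (\<forall>u \<in> {0<..T}. K u = rl_kernel H u) \<and>
     closure {u. u \<noteq> 0 \<and> K u \<noteq> 0} \<subseteq> {0..2 * T} \<and>
     (\<exists>C>0. \<forall>k\<in>{0, 1, 2::nat}. \<forall>u. u \<noteq> 0 \<longrightarrow>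
        \<bar>(deriv ^^ k) K u\<bar> \<le> C * \<bar>(deriv ^^ k) (rl_kernel H) u\<bar>)"

text \<open>In the following two predicates the processes are continuous versions, indexed by
  \<open>[0,\<infinity>)\<close> and by \<open>\<real>\<close>, respectively.\<close>

definition rl_process ::
    "'a measure \<Rightarrow> (real \<Rightarrow> 'a \<Rightarrow> real) \<Rightarrow> real \<Rightarrow> (real \<Rightarrow> 'a \<Rightarrow> real) \<Rightarrow> bool" where
  "rl_process M W H X \<longleftrightarrow>
     (\<forall>t\<ge>0. has_wiener_integral M W {0..t} (\<lambda>s. rl_kernel H (t - s)) (X t)) \<and>
     (AE \<omega> in M. continuous_on {0..} (\<lambda>t. X t \<omega>))"

definition stationary_process ::
    "'a measure \<Rightarrow> (real \<Rightarrow> 'a \<Rightarrow> real) \<Rightarrow> (real \<Rightarrow> real) \<Rightarrow> (real \<Rightarrow> 'a \<Rightarrow> real) \<Rightarrow> bool" where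
  "stationary_process M W K X \<longleftrightarrow>
     (\<forall>t. has_wiener_integral M W {..t} (\<lambda>s. K (t - s)) (X t)) \<and>
     (AE \<omega> in M. continuous_on UNIV (\<lambda>t. X t \<omega>))"

definition rough_remainder ::
    "(real \<Rightarrow> real) \<Rightarrow> (real \<Rightarrow> real) \<Rightarrow> (real \<Rightarrow> real) \<Rightarrow> real \<Rightarrow> real \<Rightarrow> real" where
  "rough_remainder X Y Y' s t = Y t - Y s - Y' s * (X t - X s)"

text \<open>The space \<open>\<D>\<^sub>X\<close> of singular controlled rough paths on \<open>(0,T]\<close>, with exponents \<open>\<gamma> + \<beta>\<close> and
  \<open>\<eta>\<close>; the suprema are taken in \<open>[0,\<infinity>]\<close>.\<close>

definition singular_controlled_paths ::
    "(real \<Rightarrow> real) \<Rightarrow> real \<Rightarrow> real \<Rightarrow> real \<Rightarrow> real \<Rightarrow> ((real \<Rightarrow> real) \<times> (real \<Rightarrow> real)) set" where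
  "singular_controlled_paths X \<gamma> \<beta> \<eta> T = {(Y, Y').
     (SUP (s, t) \<in> {(s, t). 0 < s \<and> s < t \<and> t \<le> T}.
        ennreal (\<bar>Y' t - Y' s\<bar> / (s powr (\<eta> - (\<gamma> + \<beta>)) * \<bar>t - s\<bar> powr \<gamma>))) +
     (SUP (s, t) \<in> {(s, t). 0 < s \<and> s < t \<and> t \<le> T}.
        ennreal (\<bar>rough_remainder X Y Y' s t\<bar> /
          (s powr (\<eta> - (\<gamma> + \<beta>)) * \<bar>t - s\<bar> powr (\<gamma> + \<beta>)))) < \<infinity>}"

end

theory Submission
  imports Defs
begin

text \<open>Let \<open>K\<close> be the modified kernel, \<open>D\<close> the difference of the stationary process and the
  Riemann-Liouville process, and \<open>\<theta> = \<gamma> + H\<close>. The remainder of the pair \<open>(WH, 1)\<close> is minus the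
  increment of \<open>D\<close>, so the claim is a weighted Hoelder bound for \<open>D\<close>.

  The two kernels coincide on \<open>(0, T]\<close>, hence for \<open>0 < t \<le> T\<close> the contributions of the noise on
  \<open>[0, t]\<close> cancel and \<open>D t\<close> is the Wiener integral of \<open>r \<mapsto> K (t - r)\<close> over \<open>[-2 T, 0]\<close>. The argument
  \<open>t - r\<close> stays away from the singularity of \<open>K\<close>, so the Wiener integral can be integrated by parts
  (\<open>wiener_integral_by_parts\<close>), which for \<open>0 < s < t \<le> T\<close> yields, almost surely,
  \<open>D t - D s = \<integral> (K' (t - r) - K' (s - r)) W r dr\<close> over \<open>[-2 T, 0]\<close>
  (\<open>stationary_minus_rl_increment\<close>).

  From \<open>\<bar>K'' x\<bar> \<le> C x powr (H - 5/2)\<close> one obtains, with \<open>q = H - \<eta> - 3/2\<close> and \<open>u = - r\<close>, the bound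
  \<open>\<bar>K' (t + u) - K' (s + u)\<bar> \<le> (C / \<theta>) u powr q * s powr (\<eta> - \<theta>) * (t - s) powr \<theta>\<close>
  (\<open>deriv_kernel_increment_bound\<close>), in which the dependence on \<open>s\<close> and \<open>t\<close> already has the desired
  form. What is left is the random factor \<open>\<integral> \<bar>r\<bar> powr q * \<bar>W r\<bar> dr\<close> over \<open>[-2 T, 0]\<close>. Since \<open>W r\<close> has
  standard deviation \<open>sqrt \<bar>r\<bar>\<close>, its expectation is finite as soon as \<open>q + 1/2 > -1\<close>, which is
  precisely \<open>\<eta> < H\<close> (\<open>AE_weighted_path_integral_finite\<close>).\<close>

section \<open>The isometry for step functions\<close>

context two_sided_brownian_motion
begin

lemma W_measurable [measurable]: "W t \<in> borel_measurable M"
  using random_variable_W .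

lemma second_moment_increment_less:
  assumes "s < t"
  shows "has_bochner_integral M (\<lambda>\<omega>. (W t \<omega> - W s \<omega>)\<^sup>2) (t - s)"
proof -
  define \<sigma> where "\<sigma> = sqrt (t - s)"
  have [simp]: "0 < \<sigma>" and \<sigma>2: "\<sigma>\<^sup>2 = t - s"
    using assms by (auto simp: \<sigma>_def)
  have D: "distributed M lborel (\<lambda>\<omega>. W t \<omega> - W s \<omega>) (normal_density 0 \<sigma>)"
    unfolding \<sigma>_def by (rule normal_increments[OF assms])
  have 1: "integrable M (\<lambda>\<omega>. (W t \<omega> - W s \<omega>)\<^sup>2)"
    using distributed_integrable[OF D, of "\<lambda>x. x\<^sup>2"] integrable_normal_moment[of \<sigma> 0 2]
    by (simp add: normal_density_nonneg)
  have "variance (\<lambda>\<omega>. W t \<omega> - W s \<omega>) = \<sigma>\<^sup>2"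
    by (rule normal_distributed_variance[OF _ D]) simp
  moreover have "expectation (\<lambda>\<omega>. W t \<omega> - W s \<omega>) = 0"
    by (rule normal_distributed_expectation[OF _ D]) simp
  ultimately show ?thesis
    using 1 \<sigma>2 by (simp add: has_bochner_integral_iff)
qed

lemma second_moment_increment:
  "has_bochner_integral M (\<lambda>\<omega>. (W t \<omega> - W s \<omega>)\<^sup>2) \<bar>t - s\<bar>"
proof (cases s t rule: linorder_cases)
  case less
  then show ?thesis using second_moment_increment_less[of s t] by simp
next
  case equal
  then show ?thesis by (simp add: has_bochner_integral_zero)
next
  case greater
  then show ?thesis
    using second_moment_increment_less[of t s] by (simp add: power2_commute)
qed

text \<open>Polarization: twice the product of the two increments is a signed sum of four squared
  increments, so the variances alone determine all covariances, also for overlapping intervals.\<close>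

lemma covariance_increments:
  assumes "a \<le> b" "c \<le> d"
  shows "has_bochner_integral M (\<lambda>\<omega>. (W b \<omega> - W a \<omega>) * (W d \<omega> - W c \<omega>))
           (max 0 (min b d - max a c))"
proof -
  have "has_bochner_integral M
     (\<lambda>\<omega>. ((W b \<omega> - W c \<omega>)\<^sup>2 + (W a \<omega> - W d \<omega>)\<^sup>2 - (W a \<omega> - W c \<omega>)\<^sup>2 - (W b \<omega> - W d \<omega>)\<^sup>2) / 2)
     ((\<bar>b - c\<bar> + \<bar>a - d\<bar> - \<bar>a - c\<bar> - \<bar>b - d\<bar>) / 2)"
    by (intro has_bochner_integral_divide_zero has_bochner_integral_add has_bochner_integral_diff
        second_moment_increment)
  moreover have "(\<bar>b - c\<bar> + \<bar>a - d\<bar> - \<bar>a - c\<bar> - \<bar>b - d\<bar>) / 2 = max 0 (min b d - max a c)"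
    using assms by (simp add: max_def min_def abs_if)
  moreover have "((W b \<omega> - W c \<omega>)\<^sup>2 + (W a \<omega> - W d \<omega>)\<^sup>2 - (W a \<omega> - W c \<omega>)\<^sup>2 - (W b \<omega> - W d \<omega>)\<^sup>2) / 2
      = (W b \<omega> - W a \<omega>) * (W d \<omega> - W c \<omega>)" for \<omega>
    by (simp add: power2_eq_square field_simps)
  ultimately show ?thesis by simp
qed

lemma step_integral_measurable [measurable]: "step_integral W p \<in> borel_measurable M"
  unfolding step_integral_def
  by (induction p) (auto simp: case_prod_beta)

end

lemma step_fun_Nil [simp]: "step_fun [] u = 0"
  and step_fun_Cons [simp]: "step_fun ((c, a, b) # p) u = c * indicator {a<..b} u + step_fun p u"
  and step_fun_append [simp]: "step_fun (p @ q) u = step_fun p u + step_fun q u"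
  by (simp_all add: step_fun_def)

lemma step_integral_Nil [simp]: "step_integral W [] \<omega> = 0"
  and step_integral_Cons [simp]:
    "step_integral W ((c, a, b) # p) \<omega> = c * (W b \<omega> - W a \<omega>) + step_integral W p \<omega>"
  and step_integral_append [simp]:
    "step_integral W (p @ q) \<omega> = step_integral W p \<omega> + step_integral W q \<omega>"
  by (simp_all add: step_integral_def)

lemma step_rep_Nil [simp]: "step_rep []"
  and step_rep_Cons [simp]: "step_rep ((c, a, b) # p) \<longleftrightarrow> a \<le> b \<and> step_rep p"
  and step_rep_append [simp]: "step_rep (p @ q) \<longleftrightarrow> step_rep p \<and> step_rep q"
  by (auto simp: step_rep_def ball_Un)

lemma step_fun_measurable [measurable]: "step_fun p \<in> borel_measurable borel"
  unfolding step_fun_def by (induction p) (auto simp: case_prod_beta)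

definition negate_steps :: "(real \<times> real \<times> real) list \<Rightarrow> (real \<times> real \<times> real) list" where
  "negate_steps = map (\<lambda>(c, a, b). (- c, a, b))"

lemma negate_steps [simp]:
  shows step_rep_negate_steps: "step_rep (negate_steps p) \<longleftrightarrow> step_rep p"
    and step_fun_negate_steps: "step_fun (negate_steps p) u = - step_fun p u"
    and step_integral_negate_steps: "step_integral W (negate_steps p) \<omega> = - step_integral W p \<omega>"
  by (induction p) (auto simp: negate_steps_def step_rep_def step_fun_def step_integral_def algebra_simps)

lemma has_bochner_integral_Ioc_product:
  fixes a b c d :: real
  shows "has_bochner_integral lborel (\<lambda>u. indicator {a<..b} u * indicator {c<..d} u :: real)
           (max 0 (min b d - max a c))"
proof -
  have fin: "emeasure lborel {l<..r :: real} < \<infinity>" for l r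
    by (cases "l \<le> r") auto
  have "(\<lambda>u. indicator {a<..b} u * indicator {c<..d} u :: real)
      = indicator {max a c<..min b d}"
    by (auto simp: fun_eq_iff indicator_def)
  moreover have "has_bochner_integral lborel (indicator {max a c<..min b d} :: real \<Rightarrow> real)
      (measure lborel {max a c<..min b d})"
    using fin by (intro has_bochner_integral_real_indicator) auto
  moreover have "measure lborel {max a c<..min b d} = max 0 (min b d - max a c)"
    by (cases "max a c \<le> min b d") (auto simp: max_def min_def)
  ultimately show ?thesis by simp
qed

context two_sided_brownian_motion
begin

lemma ito_polarized_single_step:
  assumes "a \<le> b" "step_rep q"
  shows "\<exists>I. has_bochner_integral M (\<lambda>\<omega>. (c * (W b \<omega> - W a \<omega>)) * step_integral W q \<omega>) I \<and>
             has_bochner_integral lborel (\<lambda>u. (c * indicator {a<..b} u) * step_fun q u) I"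
  using assms(2)
proof (induction q)
  case Nil
  then show ?case by (auto intro: has_bochner_integral_zero)
next
  case (Cons x q)
  obtain c' a' b' where x: "x = (c', a', b')" by (cases x)
  from Cons x obtain I where
    I: "has_bochner_integral M (\<lambda>\<omega>. (c * (W b \<omega> - W a \<omega>)) * step_integral W q \<omega>) I"
       "has_bochner_integral lborel (\<lambda>u. (c * indicator {a<..b} u) * step_fun q u) I"
    by auto
  have "a' \<le> b'" using Cons.prems x by simp
  have 1: "has_bochner_integral M
      (\<lambda>\<omega>. (c * c') * ((W b \<omega> - W a \<omega>) * (W b' \<omega> - W a' \<omega>)) +
        (c * (W b \<omega> - W a \<omega>)) * step_integral W q \<omega>)
      ((c * c') * (max 0 (min b b' - max a a')) + I)"
    by (intro has_bochner_integral_add I has_bochner_integral_mult_right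
        covariance_increments assms \<open>a' \<le> b'\<close>)
  have 2: "has_bochner_integral lborel
      (\<lambda>u. (c * c') * (indicator {a<..b} u * indicator {a'<..b'} u) +
        (c * indicator {a<..b} u) * step_fun q u)
      ((c * c') * (max 0 (min b b' - max a a')) + I)"
    by (intro has_bochner_integral_add I has_bochner_integral_mult_right
        has_bochner_integral_Ioc_product)
  show ?case
    using 1 2 by (intro exI[of _ "(c * c') * (max 0 (min b b' - max a a')) + I"])
      (simp add: x algebra_simps)
qed

text \<open>The covariance of two increments is the length of the overlap of their intervals, which is also
  the inner product of the two indicator functions in \<open>L\<^sup>2(\<real>)\<close>; both sides are bilinear in \<open>p\<close> and
  \<open>q\<close>. The value \<open>I\<close> is left unnamed so that the induction carries integrability along.\<close>

lemma ito_polarized: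
  assumes "step_rep p" "step_rep q"
  shows "\<exists>I. has_bochner_integral M (\<lambda>\<omega>. step_integral W p \<omega> * step_integral W q \<omega>) I \<and>
             has_bochner_integral lborel (\<lambda>u. step_fun p u * step_fun q u) I"
  using assms(1)
proof (induction p)
  case Nil
  then show ?case by (auto intro: has_bochner_integral_zero)
next
  case (Cons x p)
  obtain c a b where x: "x = (c, a, b)" by (cases x)
  from Cons x obtain I where
    I: "has_bochner_integral M (\<lambda>\<omega>. step_integral W p \<omega> * step_integral W q \<omega>) I"
       "has_bochner_integral lborel (\<lambda>u. step_fun p u * step_fun q u) I"
    by auto
  have "a \<le> b" using Cons.prems x by simp
  from ito_polarized_single_step[OF this assms(2), of c] obtain J where
    J: "has_bochner_integral M (\<lambda>\<omega>. (c * (W b \<omega> - W a \<omega>)) * step_integral W q \<omega>) J"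
       "has_bochner_integral lborel (\<lambda>u. (c * indicator {a<..b} u) * step_fun q u) J"
    by auto
  show ?case
    using has_bochner_integral_add[OF J(1) I(1)] has_bochner_integral_add[OF J(2) I(2)]
    by (intro exI[of _ "J + I"]) (simp add: x algebra_simps)
qed

lemma ito_isometry_steps:
  assumes "step_rep p"
  shows "(\<integral>\<^sup>+ \<omega>. ennreal ((step_integral W p \<omega>)\<^sup>2) \<partial>M) = (\<integral>\<^sup>+ u. ennreal ((step_fun p u)\<^sup>2) \<partial>lborel)"
proof -
  from ito_polarized[OF assms assms] obtain I where
    I: "has_bochner_integral M (\<lambda>\<omega>. (step_integral W p \<omega>)\<^sup>2) I"
       "has_bochner_integral lborel (\<lambda>u. (step_fun p u)\<^sup>2) I"
    by (auto simp: power2_eq_square)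
  then show ?thesis
    by (simp add: nn_integral_eq_integral has_bochner_integral_iff)
qed

end

section \<open>Wiener integrals as limits\<close>

lemma nn_integral_square_triangle:
  fixes f g h :: "'a \<Rightarrow> real"
  assumes [measurable]: "f \<in> borel_measurable N" "g \<in> borel_measurable N" "h \<in> borel_measurable N"
  shows "(\<integral>\<^sup>+ x. ennreal ((f x - h x)\<^sup>2) \<partial>N) \<le>
    2 * (\<integral>\<^sup>+ x. ennreal ((f x - g x)\<^sup>2) \<partial>N) + 2 * (\<integral>\<^sup>+ x. ennreal ((g x - h x)\<^sup>2) \<partial>N)"
proof -
  have "(f x - h x)\<^sup>2 \<le> 2 * (f x - g x)\<^sup>2 + 2 * (g x - h x)\<^sup>2" for x
    using zero_le_power2[of "(f x - g x) - (g x - h x)"]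
    by (simp add: power2_eq_square algebra_simps)
  then have "ennreal ((f x - h x)\<^sup>2) \<le> ennreal (2 * (f x - g x)\<^sup>2 + 2 * (g x - h x)\<^sup>2)" for x
    by (rule ennreal_leI)
  moreover have "ennreal (2 * (f x - g x)\<^sup>2 + 2 * (g x - h x)\<^sup>2) =
      2 * ennreal ((f x - g x)\<^sup>2) + 2 * ennreal ((g x - h x)\<^sup>2)" for x
    by (simp add: ennreal_plus ennreal_mult)
  ultimately have "ennreal ((f x - h x)\<^sup>2) \<le>
      2 * ennreal ((f x - g x)\<^sup>2) + 2 * ennreal ((g x - h x)\<^sup>2)" for x
    by metis
  then have "(\<integral>\<^sup>+ x. ennreal ((f x - h x)\<^sup>2) \<partial>N) \<le>
      (\<integral>\<^sup>+ x. 2 * ennreal ((f x - g x)\<^sup>2) + 2 * ennreal ((g x - h x)\<^sup>2) \<partial>N)"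
    by (intro nn_integral_mono) auto
  then show ?thesis
    by (simp add: nn_integral_add nn_integral_cmult)
qed

lemma mean_square_limit_triangle:
  fixes f h :: "nat \<Rightarrow> 'a \<Rightarrow> real" and g :: "'a \<Rightarrow> real"
  assumes [measurable]: "\<And>n. f n \<in> borel_measurable N" "g \<in> borel_measurable N"
      "\<And>n. h n \<in> borel_measurable N"
    and "(\<lambda>n. \<integral>\<^sup>+ x. ennreal ((f n x - g x)\<^sup>2) \<partial>N) \<longlonglongrightarrow> 0"
    and "(\<lambda>n. \<integral>\<^sup>+ x. ennreal ((g x - h n x)\<^sup>2) \<partial>N) \<longlonglongrightarrow> 0"
  shows "(\<lambda>n. \<integral>\<^sup>+ x. ennreal ((f n x - h n x)\<^sup>2) \<partial>N) \<longlonglongrightarrow> 0"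
proof (rule tendsto_sandwich[OF _ _ tendsto_const])
  show "(\<lambda>n. 2 * (\<integral>\<^sup>+ x. ennreal ((f n x - g x)\<^sup>2) \<partial>N) +
      2 * (\<integral>\<^sup>+ x. ennreal ((g x - h n x)\<^sup>2) \<partial>N)) \<longlonglongrightarrow> 0"
    using tendsto_add[OF ennreal_tendsto_cmult[OF _ assms(4), of 2]
        ennreal_tendsto_cmult[OF _ assms(5), of 2]] by simp
  show "\<forall>\<^sub>F n in sequentially. (\<integral>\<^sup>+ x. ennreal ((f n x - h n x)\<^sup>2) \<partial>N) \<le>
      2 * (\<integral>\<^sup>+ x. ennreal ((f n x - g x)\<^sup>2) \<partial>N) + 2 * (\<integral>\<^sup>+ x. ennreal ((g x - h n x)\<^sup>2) \<partial>N)"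
    by (intro always_eventually allI nn_integral_square_triangle) auto
qed simp

context two_sided_brownian_motion
begin

text \<open>By the isometry the limit does not depend on the approximating sequence: the definition of the
  Wiener integral provides some sequence of step functions, and it may be exchanged for any other
  one with the same limit in \<open>L\<^sup>2\<close>.\<close>

lemma step_integrals_converge_to_wiener_integral:
  assumes X: "has_wiener_integral M W A f X"
    and q: "\<And>n. step_rep (q n)"
    and lim: "(\<lambda>n. \<integral>\<^sup>+ u. ennreal ((indicator A u * f u - step_fun (q n) u)\<^sup>2) \<partial>lborel) \<longlonglongrightarrow> 0"
  shows "(\<lambda>n. \<integral>\<^sup>+ \<omega>. ennreal ((X \<omega> - step_integral W (q n) \<omega>)\<^sup>2) \<partial>M) \<longlonglongrightarrow> 0"
proof -
  from X obtain p where
    [measurable]: "(\<lambda>u. indicator A u * f u) \<in> borel_measurable borel" "X \<in> borel_measurable M"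
    and p: "\<And>n. step_rep (p n)"
    and pf: "(\<lambda>n. \<integral>\<^sup>+ u. ennreal ((indicator A u * f u - step_fun (p n) u)\<^sup>2) \<partial>lborel) \<longlonglongrightarrow> 0"
    and pX: "(\<lambda>n. \<integral>\<^sup>+ \<omega>. ennreal ((X \<omega> - step_integral W (p n) \<omega>)\<^sup>2) \<partial>M) \<longlonglongrightarrow> 0"
    unfolding has_wiener_integral_def by auto
  have "(\<lambda>n. \<integral>\<^sup>+ u. ennreal ((step_fun (p n) u - step_fun (q n) u)\<^sup>2) \<partial>lborel) \<longlonglongrightarrow> 0"
    by (rule mean_square_limit_triangle[where g = "\<lambda>u. indicator A u * f u"])
      (measurable, subst power2_commute, rule pf, rule lim)
  moreover have "(\<integral>\<^sup>+ u. ennreal ((step_fun (p n) u - step_fun (q n) u)\<^sup>2) \<partial>lborel) =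
      (\<integral>\<^sup>+ \<omega>. ennreal ((step_integral W (p n) \<omega> - step_integral W (q n) \<omega>)\<^sup>2) \<partial>M)" for n
    using ito_isometry_steps[of "p n @ negate_steps (q n)"] p[of n] q[of n] by simp
  ultimately have pq:
    "(\<lambda>n. \<integral>\<^sup>+ \<omega>. ennreal ((step_integral W (p n) \<omega> - step_integral W (q n) \<omega>)\<^sup>2) \<partial>M) \<longlonglongrightarrow> 0"
    by simp
  show ?thesis
  proof (rule tendsto_sandwich[OF _ _ tendsto_const])
    show "(\<lambda>n. 2 * (\<integral>\<^sup>+ \<omega>. ennreal ((X \<omega> - step_integral W (p n) \<omega>)\<^sup>2) \<partial>M) +
        2 * (\<integral>\<^sup>+ \<omega>. ennreal ((step_integral W (p n) \<omega> - step_integral W (q n) \<omega>)\<^sup>2) \<partial>M)) \<longlonglongrightarrow> 0"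
      using tendsto_add[OF ennreal_tendsto_cmult[OF _ pX, of 2] ennreal_tendsto_cmult[OF _ pq, of 2]]
      by simp
    show "\<forall>\<^sub>F n in sequentially. (\<integral>\<^sup>+ \<omega>. ennreal ((X \<omega> - step_integral W (q n) \<omega>)\<^sup>2) \<partial>M) \<le>
        2 * (\<integral>\<^sup>+ \<omega>. ennreal ((X \<omega> - step_integral W (p n) \<omega>)\<^sup>2) \<partial>M) +
        2 * (\<integral>\<^sup>+ \<omega>. ennreal ((step_integral W (p n) \<omega> - step_integral W (q n) \<omega>)\<^sup>2) \<partial>M)"
      by (intro always_eventually allI nn_integral_square_triangle) auto
  qed simp
qed

text \<open>Fatou's lemma identifies the mean-square limit with the pathwise one.\<close>

lemma wiener_integral_eq_pathwise_limit:
  assumes X: "has_wiener_integral M W A f X"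
    and q: "\<And>n. step_rep (q n)"
    and lim: "(\<lambda>n. \<integral>\<^sup>+ u. ennreal ((indicator A u * f u - step_fun (q n) u)\<^sup>2) \<partial>lborel) \<longlonglongrightarrow> 0"
    and Z: "AE \<omega> in M. (\<lambda>n. step_integral W (q n) \<omega>) \<longlonglongrightarrow> Z \<omega>"
  shows "AE \<omega> in M. X \<omega> = Z \<omega>"
proof -
  have [measurable]: "X \<in> borel_measurable M"
    using X by (simp add: has_wiener_integral_def)
  let ?g = "\<lambda>n \<omega>. ennreal ((X \<omega> - step_integral W (q n) \<omega>)\<^sup>2)"
  have "(\<integral>\<^sup>+ \<omega>. liminf (\<lambda>n. ?g n \<omega>) \<partial>M) \<le> liminf (\<lambda>n. \<integral>\<^sup>+ \<omega>. ?g n \<omega> \<partial>M)"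
    by (intro nn_integral_liminf) measurable
  also have "\<dots> = 0"
    using step_integrals_converge_to_wiener_integral[OF X q lim]
    by (intro lim_imp_Liminf) auto
  finally have "AE \<omega> in M. liminf (\<lambda>n. ?g n \<omega>) = 0"
    by (subst (asm) le_zero_eq, subst (asm) nn_integral_0_iff_AE) auto
  with Z show ?thesis
  proof eventually_elim
    case (elim \<omega>)
    have "(\<lambda>n. ?g n \<omega>) \<longlonglongrightarrow> ennreal ((X \<omega> - Z \<omega>)\<^sup>2)"
      by (intro tendsto_intros elim)
    then have "liminf (\<lambda>n. ?g n \<omega>) = ennreal ((X \<omega> - Z \<omega>)\<^sup>2)"
      by (intro lim_imp_Liminf) auto
    with elim show ?case by simp
  qed
qed

lemma has_wiener_integral_diff:
  assumes X: "has_wiener_integral M W A f X" and Y: "has_wiener_integral M W B g Y"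
  shows "has_wiener_integral M W UNIV (\<lambda>u. indicator A u * f u - indicator B u * g u)
           (\<lambda>\<omega>. X \<omega> - Y \<omega>)"
proof -
  let ?f = "\<lambda>u. indicator A u * f u" and ?g = "\<lambda>u. indicator B u * g u"
  from X obtain p where
    [measurable]: "?f \<in> borel_measurable borel" "X \<in> borel_measurable M"
    and f2: "integrable lborel (\<lambda>u. (?f u)\<^sup>2)"
    and p: "\<And>n. step_rep (p n)"
    and pf: "(\<lambda>n. \<integral>\<^sup>+ u. ennreal ((?f u - step_fun (p n) u)\<^sup>2) \<partial>lborel) \<longlonglongrightarrow> 0"
    and pX: "(\<lambda>n. \<integral>\<^sup>+ \<omega>. ennreal ((X \<omega> - step_integral W (p n) \<omega>)\<^sup>2) \<partial>M) \<longlonglongrightarrow> 0"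
    unfolding has_wiener_integral_def by auto
  from Y obtain q where
    [measurable]: "?g \<in> borel_measurable borel" "Y \<in> borel_measurable M"
    and g2: "integrable lborel (\<lambda>u. (?g u)\<^sup>2)"
    and q: "\<And>n. step_rep (q n)"
    and qg: "(\<lambda>n. \<integral>\<^sup>+ u. ennreal ((?g u - step_fun (q n) u)\<^sup>2) \<partial>lborel) \<longlonglongrightarrow> 0"
    and qY: "(\<lambda>n. \<integral>\<^sup>+ \<omega>. ennreal ((Y \<omega> - step_integral W (q n) \<omega>)\<^sup>2) \<partial>M) \<longlonglongrightarrow> 0"
    unfolding has_wiener_integral_def by auto
  have "integrable lborel (\<lambda>u. (?f u - ?g u)\<^sup>2)"
  proof (rule Bochner_Integration.integrable_bound)
    show "integrable lborel (\<lambda>u. 2 * (?f u)\<^sup>2 + 2 * (?g u)\<^sup>2)"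
      using f2 g2 by auto
    have "(x - y)\<^sup>2 \<le> 2 * x\<^sup>2 + 2 * y\<^sup>2" for x y :: real
      using zero_le_power2[of "x + y"] by (simp add: power2_eq_square algebra_simps)
    then show "AE u in lborel. norm ((?f u - ?g u)\<^sup>2) \<le> norm (2 * (?f u)\<^sup>2 + 2 * (?g u)\<^sup>2)"
      by (auto intro!: order_trans[OF _ abs_ge_self])
  qed measurable
  moreover have "(\<lambda>n. \<integral>\<^sup>+ u. ennreal ((?f u - ?g u - step_fun (p n @ negate_steps (q n)) u)\<^sup>2) \<partial>lborel)
      \<longlonglongrightarrow> 0"
  proof -
    have "(\<lambda>n. \<integral>\<^sup>+ u. ennreal ((?f u - step_fun (p n) u - (?g u - step_fun (q n) u))\<^sup>2) \<partial>lborel) \<longlonglongrightarrow> 0"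
      by (rule mean_square_limit_triangle[where g = "\<lambda>_. 0"])
        (measurable, use pf in simp, subst power2_commute, use qg in simp)
    then show ?thesis by (simp add: algebra_simps)
  qed
  moreover have "(\<lambda>n. \<integral>\<^sup>+ \<omega>. ennreal ((X \<omega> - Y \<omega> - step_integral W (p n @ negate_steps (q n)) \<omega>)\<^sup>2) \<partial>M)
      \<longlonglongrightarrow> 0"
  proof -
    have "(\<lambda>n. \<integral>\<^sup>+ \<omega>. ennreal ((X \<omega> - step_integral W (p n) \<omega> - (Y \<omega> - step_integral W (q n) \<omega>))\<^sup>2) \<partial>M) \<longlonglongrightarrow> 0"
      by (rule mean_square_limit_triangle[where g = "\<lambda>_. 0"])
        (measurable, use pX in simp, subst power2_commute, use qY in simp)
    then show ?thesis by (simp add: algebra_simps)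
  qed
  moreover have "step_rep (p n @ negate_steps (q n))" for n
    using p q by simp
  ultimately show ?thesis
    unfolding has_wiener_integral_def
    by (auto intro!: exI[of _ "\<lambda>n. p n @ negate_steps (q n)"])
qed

end

lemma has_wiener_integral_cong_AE:
  assumes X: "has_wiener_integral M W A f X"
    and meas [measurable]: "(\<lambda>u. indicator B u * g u) \<in> borel_measurable borel"
    and eq: "AE u in lborel. indicator A u * f u = indicator B u * g u"
  shows "has_wiener_integral M W B g X"
proof -
  let ?f = "\<lambda>u. indicator A u * f u" and ?g = "\<lambda>u. indicator B u * g u"
  from X obtain p where
    [measurable]: "?f \<in> borel_measurable borel" "X \<in> borel_measurable M"
    and f2: "integrable lborel (\<lambda>u. (?f u)\<^sup>2)"
    and p: "\<And>n. step_rep (p n)"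
    and pf: "(\<lambda>n. \<integral>\<^sup>+ u. ennreal ((?f u - step_fun (p n) u)\<^sup>2) \<partial>lborel) \<longlonglongrightarrow> 0"
    and pX: "(\<lambda>n. \<integral>\<^sup>+ \<omega>. ennreal ((X \<omega> - step_integral W (p n) \<omega>)\<^sup>2) \<partial>M) \<longlonglongrightarrow> 0"
    unfolding has_wiener_integral_def by auto
  have "integrable lborel (\<lambda>u. (?g u)\<^sup>2)"
    by (rule integrable_cong_AE_imp[OF f2]) (use eq in auto)
  moreover have "(\<integral>\<^sup>+ u. ennreal ((?f u - step_fun (p n) u)\<^sup>2) \<partial>lborel) =
      (\<integral>\<^sup>+ u. ennreal ((?g u - step_fun (p n) u)\<^sup>2) \<partial>lborel)" for n
    by (rule nn_integral_cong_AE) (use eq in auto)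
  ultimately show ?thesis
    using p pf pX unfolding has_wiener_integral_def by auto
qed

section \<open>Integration by parts for Wiener integrals\<close>

definition grid_point :: "real \<Rightarrow> real \<Rightarrow> nat \<Rightarrow> nat \<Rightarrow> real" where
  "grid_point a b n i = a + (b - a) * real i / real (Suc n)"

definition riemann_steps ::
    "(real \<Rightarrow> real) \<Rightarrow> real \<Rightarrow> real \<Rightarrow> nat \<Rightarrow> (real \<times> real \<times> real) list" where
  "riemann_steps f a b n =
     map (\<lambda>i. (f (grid_point a b n i), grid_point a b n i, grid_point a b n (Suc i))) [0..<Suc n]"

lemma grid_point_0 [simp]: "grid_point a b n 0 = a"
  by (simp add: grid_point_def)

lemma grid_point_Suc_n [simp]: "grid_point a b n (Suc n) = b"
proof -
  have "(b - a) * real (Suc n) / real (Suc n) = b - a"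
    by (rule nonzero_mult_div_cancel_right) simp
  then show ?thesis unfolding grid_point_def by linarith
qed

lemma grid_point_diff:
  "grid_point a b n (Suc i) - grid_point a b n i = (b - a) / real (Suc n)"
proof -
  have "(b - a) * real (Suc i) = (b - a) * real i + (b - a)"
    by (simp add: algebra_simps)
  then show ?thesis
    unfolding grid_point_def by (simp only: add_divide_distrib)
qed

lemma grid_point_mono:
  assumes "a \<le> b" "i \<le> j"
  shows "grid_point a b n i \<le> grid_point a b n j"
  using assms by (auto simp: grid_point_def intro!: divide_right_mono mult_left_mono)

lemma grid_point_in_interval:
  assumes "a \<le> b" "i \<le> Suc n"
  shows "grid_point a b n i \<in> {a..b}"
  using grid_point_mono[OF assms(1), of 0 i n] grid_point_mono[OF assms, of n] by simp

lemma step_rep_riemann_steps: "a \<le> b \<Longrightarrow> step_rep (riemann_steps f a b n)"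
  by (auto simp: step_rep_def riemann_steps_def simp del: upt_Suc grid_point_Suc_n
      intro!: grid_point_mono)

lemma step_fun_riemann_steps:
  "step_fun (riemann_steps f a b n) u =
     (\<Sum>i<Suc n. f (grid_point a b n i) * indicator {grid_point a b n i<..grid_point a b n (Suc i)} u)"
  by (simp add: step_fun_def riemann_steps_def interv_sum_list_conv_sum_set_nat comp_def
      del: upt_Suc sum.lessThan_Suc flip: atLeast0LessThan)

lemma step_integral_riemann_steps:
  "step_integral W (riemann_steps f a b n) \<omega> =
     (\<Sum>i<Suc n. f (grid_point a b n i) * (W (grid_point a b n (Suc i)) \<omega> - W (grid_point a b n i) \<omega>))"
  by (simp add: step_integral_def riemann_steps_def interv_sum_list_conv_sum_set_nat comp_def
      del: upt_Suc sum.lessThan_Suc flip: atLeast0LessThan)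

lemma sum_indicator_grid:
  assumes "a \<le> b"
  shows "(\<Sum>i<k. indicator {grid_point a b n i<..grid_point a b n (Suc i)} u) =
     (indicator {a<..grid_point a b n k} u :: real)"
proof (induction k)
  case (Suc k)
  have "grid_point a b n k \<le> grid_point a b n (Suc k)" "a \<le> grid_point a b n k"
    using grid_point_mono[OF assms, of 0 k n] by (auto intro: grid_point_mono assms)
  then show ?case
    by (simp add: Suc) (auto simp: indicator_def)
qed simp

text \<open>The left end point \<open>a\<close> is excluded because the cells of the grid are half open.\<close>

lemma riemann_steps_uniform_error:
  assumes "a \<le> b" "u \<noteq> a"
    and lip: "\<And>x y. x \<in> {a..b} \<Longrightarrow> y \<in> {a..b} \<Longrightarrow> \<bar>f x - f y\<bar> \<le> L * \<bar>x - y\<bar>" and "L \<ge> 0"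
  shows "\<bar>indicator {a..b} u * f u - step_fun (riemann_steps f a b n) u\<bar>
     \<le> L * ((b - a) / real (Suc n)) * indicator {a<..b} u"
proof -
  define I :: "nat \<Rightarrow> real" where
    "I i = indicator {grid_point a b n i<..grid_point a b n (Suc i)} u" for i
  have sumI: "(\<Sum>i<Suc n. I i) = indicator {a<..b} u"
    unfolding I_def using sum_indicator_grid[OF assms(1), of n u "Suc n"]
    by (simp only: grid_point_Suc_n)
  have "indicator {a..b} u * f u = f u * (\<Sum>i<Suc n. I i)"
    unfolding sumI using assms(2) by (auto simp: indicator_def)
  then have "\<bar>indicator {a..b} u * f u - step_fun (riemann_steps f a b n) u\<bar>
      = \<bar>\<Sum>i<Suc n. (f u - f (grid_point a b n i)) * I i\<bar>"
    by (simp only: step_fun_riemann_steps I_def sum_distrib_left left_diff_distrib sum_subtractf)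
  also have "\<dots> \<le> (\<Sum>i<Suc n. \<bar>(f u - f (grid_point a b n i)) * I i\<bar>)"
    by (rule sum_abs)
  also have "\<dots> \<le> (\<Sum>i<Suc n. L * ((b - a) / real (Suc n)) * I i)"
  proof (rule sum_mono)
    fix i assume "i \<in> {..<Suc n}"
    then have i: "grid_point a b n i \<in> {a..b}" "grid_point a b n (Suc i) \<in> {a..b}"
      by (auto simp del: atLeastAtMost_iff intro!: grid_point_in_interval assms)
    show "\<bar>(f u - f (grid_point a b n i)) * I i\<bar> \<le> L * ((b - a) / real (Suc n)) * I i"
    proof (cases "u \<in> {grid_point a b n i<..grid_point a b n (Suc i)}")
      case True
      with i have "\<bar>f u - f (grid_point a b n i)\<bar> \<le> L * \<bar>u - grid_point a b n i\<bar>"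
        by (intro lip) auto
      also have "\<dots> \<le> L * ((b - a) / real (Suc n))"
        using True grid_point_diff[of a b n i] \<open>L \<ge> 0\<close> by (intro mult_left_mono) auto
      finally show ?thesis using True by (simp add: I_def)
    qed (simp add: I_def)
  qed
  also have "\<dots> = L * ((b - a) / real (Suc n)) * indicator {a<..b} u"
    by (simp only: sumI flip: sum_distrib_left)
  finally show ?thesis .
qed

lemma tendsto_grid_mesh: "(\<lambda>n. c / real (Suc n)) \<longlonglongrightarrow> 0"
  using LIMSEQ_Suc[OF lim_const_over_n[of c]] by simp

lemma riemann_steps_tendsto_L2:
  assumes "a \<le> b"
    and lip: "\<And>x y. x \<in> {a..b} \<Longrightarrow> y \<in> {a..b} \<Longrightarrow> \<bar>f x - f y\<bar> \<le> L * \<bar>x - y\<bar>" and "L \<ge> 0"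
  shows "(\<lambda>n. \<integral>\<^sup>+ u. ennreal ((indicator {a..b} u * f u - step_fun (riemann_steps f a b n) u)\<^sup>2)
           \<partial>lborel) \<longlonglongrightarrow> 0"
proof (rule tendsto_sandwich[OF _ _ tendsto_const])
  let ?h = "\<lambda>n. L * ((b - a) / real (Suc n))"
  show "(\<lambda>n. ennreal ((?h n)\<^sup>2 * (b - a))) \<longlonglongrightarrow> 0"
  proof -
    have "(\<lambda>n. (?h n)\<^sup>2 * (b - a)) \<longlonglongrightarrow> (L * 0)\<^sup>2 * (b - a)"
      by (intro tendsto_intros tendsto_grid_mesh)
    from tendsto_ennrealI[OF this] show ?thesis by simp
  qed
  show "\<forall>\<^sub>F n in sequentially. (\<integral>\<^sup>+ u. ennreal ((indicator {a..b} u * f u -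
      step_fun (riemann_steps f a b n) u)\<^sup>2) \<partial>lborel) \<le> ennreal ((?h n)\<^sup>2 * (b - a))"
  proof (intro always_eventually allI)
    fix n
    have "(\<integral>\<^sup>+ u. ennreal ((indicator {a..b} u * f u - step_fun (riemann_steps f a b n) u)\<^sup>2) \<partial>lborel)
        \<le> (\<integral>\<^sup>+ u. ennreal ((?h n)\<^sup>2) * indicator {a<..b} u \<partial>lborel)"
    proof (rule nn_integral_mono_AE)
      show "AE u in lborel. ennreal ((indicator {a..b} u * f u - step_fun (riemann_steps f a b n) u)\<^sup>2)
          \<le> ennreal ((?h n)\<^sup>2) * indicator {a<..b} u"
        using AE_lborel_singleton[of a]
      proof eventually_elim
        case (elim u)
        have "\<bar>indicator {a..b} u * f u - step_fun (riemann_steps f a b n) u\<bar>\<^sup>2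
            \<le> (?h n * indicator {a<..b} u)\<^sup>2"
          by (intro power_mono riemann_steps_uniform_error assms elim) auto
        then show ?case
          by (auto simp: indicator_def intro!: ennreal_leI)
      qed
    qed
    also have "\<dots> = ennreal ((?h n)\<^sup>2 * (b - a))"
      using assms(1) by (simp add: nn_integral_cmult ennreal_mult)
    finally show "(\<integral>\<^sup>+ u. ennreal ((indicator {a..b} u * f u -
      step_fun (riemann_steps f a b n) u)\<^sup>2) \<partial>lborel) \<le> ennreal ((?h n)\<^sup>2 * (b - a))" .
  qed
qed simp

lemma summation_by_parts:
  fixes f w :: "nat \<Rightarrow> real"
  shows "(\<Sum>i<n. f i * (w (Suc i) - w i)) = f n * w n - f 0 * w 0 - (\<Sum>i<n. w (Suc i) * (f (Suc i) - f i))"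
  by (induction n) (simp_all add: algebra_simps)

lemma continuous_on_Icc_bounded:
  fixes g :: "real \<Rightarrow> real"
  assumes "continuous_on {a..b} g"
  shows "\<exists>B>0. \<forall>x\<in>{a..b}. \<bar>g x\<bar> \<le> B"
  using compact_imp_bounded[OF compact_continuous_image[OF assms]] by (simp add: bounded_pos)

text \<open>Summation by parts moves the increments onto \<open>f\<close>. On each cell the mean value inequality is
  applied to \<open>G - c f\<close>, where \<open>G\<close> is a primitive of \<open>f' w\<close> and \<open>c\<close> is the value of \<open>w\<close> at the right end point;
  its derivative \<open>f' (w - c)\<close> is small by uniform continuity of \<open>w\<close>, and the increments of \<open>G\<close>
  telescope to the integral.\<close>

lemma riemann_stieltjes_integration_by_parts:
  fixes f f' w :: "real \<Rightarrow> real"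
  assumes "a < b"
    and df: "\<And>x. x \<in> {a..b} \<Longrightarrow> (f has_real_derivative f' x) (at x within {a..b})"
    and cf': "continuous_on {a..b} f'" and cw: "continuous_on {a..b} w"
  shows "(\<lambda>n. \<Sum>i<Suc n. f (grid_point a b n i) * (w (grid_point a b n (Suc i)) - w (grid_point a b n i)))
     \<longlonglongrightarrow> f b * w b - f a * w a - integral {a..b} (\<lambda>x. f' x * w x)"
proof -
  define G where "G x = integral {a..x} (\<lambda>x. f' x * w x)" for x
  define r where "r = grid_point a b"
  have dG: "(G has_real_derivative f' x * w x) (at x within {a..b})" if "x \<in> {a..b}" for x
    unfolding G_def using that by (intro integral_has_real_derivative continuous_intros cf' cw)
  have r: "r n i \<in> {a..b}" if "i \<le> Suc n" for n i
    unfolding r_def using that assms(1) by (intro grid_point_in_interval) auto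
  obtain B where B: "\<And>x. x \<in> {a..b} \<Longrightarrow> \<bar>f' x\<bar> \<le> B" "B > 0"
    using continuous_on_Icc_bounded[OF cf'] by blast
  have "(\<lambda>n. \<Sum>i<Suc n. w (r n (Suc i)) * (f (r n (Suc i)) - f (r n i))) \<longlonglongrightarrow> G b"
  proof (rule LIMSEQ_I)
    fix e :: real assume "e > 0"
    define d where "d = e / (2 * (B * (b - a)))"
    have d: "d > 0" and d_eq: "d * B * (b - a) = e / 2"
      using \<open>e > 0\<close> \<open>B > 0\<close> \<open>a < b\<close> by (auto simp: d_def field_simps)
    have "uniformly_continuous_on {a..b} w"
      by (intro compact_uniformly_continuous cw) simp
    with d obtain \<delta> where \<delta>: "\<delta> > 0"
      "\<And>x y. x \<in> {a..b} \<Longrightarrow> y \<in> {a..b} \<Longrightarrow> \<bar>x - y\<bar> < \<delta> \<Longrightarrow> \<bar>w x - w y\<bar> < d"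
      unfolding uniformly_continuous_on_def dist_real_def by metis
    from LIMSEQ_D[OF tendsto_grid_mesh[of "b - a"] \<delta>(1)] obtain N where
      N: "\<And>n. n \<ge> N \<Longrightarrow> (b - a) / real (Suc n) < \<delta>"
      using assms(1) by (auto simp: abs_less_iff)
    have "\<bar>(\<Sum>i<Suc n. w (r n (Suc i)) * (f (r n (Suc i)) - f (r n i))) - G b\<bar> < e" if "n \<ge> N" for n
    proof -
      have cell: "\<bar>(G (r n (Suc i)) - G (r n i)) - w (r n (Suc i)) * (f (r n (Suc i)) - f (r n i))\<bar>
          \<le> d * B * ((b - a) / real (Suc n))" if i: "i < Suc n" for i
      proof -
        define c where "c = w (r n (Suc i))"
        have step: "r n (Suc i) - r n i = (b - a) / real (Suc n)"
          unfolding r_def by (rule grid_point_diff)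
        have sub: "{r n i..r n (Suc i)} \<subseteq> {a..b}"
          using r[of i n] r[of "Suc i" n] i by auto
        have le: "r n i \<le> r n (Suc i)"
          using step assms(1) by (smt (verit) divide_nonneg_nonneg of_nat_0_le_iff)
        have "norm ((G (r n (Suc i)) - c * f (r n (Suc i))) - (G (r n i) - c * f (r n i)))
            \<le> d * B * norm (r n (Suc i) - r n i)"
        proof (rule field_differentiable_bound[where S = "{r n i..r n (Suc i)}"
              and f' = "\<lambda>x. f' x * w x - c * f' x"])
          fix x assume x: "x \<in> {r n i..r n (Suc i)}"
          with sub have xab: "x \<in> {a..b}" by auto
          show "((\<lambda>x. G x - c * f x) has_real_derivative f' x * w x - c * f' x)
              (at x within {r n i..r n (Suc i)})"
            by (rule DERIV_subset[OF _ sub])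
              (rule DERIV_diff[OF dG[OF xab] DERIV_cmult[OF df[OF xab]]])
          have "\<bar>x - r n (Suc i)\<bar> \<le> (b - a) / real (Suc n)"
            using x step by auto
          with N[OF \<open>n \<ge> N\<close>] have "\<bar>w x - c\<bar> < d"
            unfolding c_def using xab r[of "Suc i" n] i by (intro \<delta>(2)) auto
          then have "\<bar>w x - c\<bar> * \<bar>f' x\<bar> \<le> d * B"
            using B(1)[OF xab] d by (intro mult_mono) auto
          then show "norm (f' x * w x - c * f' x) \<le> d * B"
            by (simp add: abs_mult[symmetric] algebra_simps)
        qed (use le in auto)
        then show ?thesis
          unfolding step c_def using assms(1) by (simp add: algebra_simps)
      qed
      have "(\<Sum>i<Suc n. G (r n (Suc i)) - G (r n i)) = G (r n (Suc n)) - G (r n 0)"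
        by (rule sum_lessThan_telescope)
      then have "G b = (\<Sum>i<Suc n. G (r n (Suc i)) - G (r n i))"
        by (simp only: r_def grid_point_0 grid_point_Suc_n) (simp add: G_def)
      then have "\<bar>(\<Sum>i<Suc n. w (r n (Suc i)) * (f (r n (Suc i)) - f (r n i))) - G b\<bar> =
        \<bar>\<Sum>i<Suc n. (G (r n (Suc i)) - G (r n i)) - w (r n (Suc i)) * (f (r n (Suc i)) - f (r n i))\<bar>"
        by (simp only: sum_subtractf abs_minus_commute)
      also have "\<dots> \<le> (\<Sum>i<Suc n. d * B * ((b - a) / real (Suc n)))"
        by (rule order_trans[OF sum_abs sum_mono]) (use cell in auto)
      also have "\<dots> = d * B * (b - a)" by (simp del: sum.lessThan_Suc)
      also have "\<dots> < e" using d_eq \<open>e > 0\<close> by simp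
      finally show ?thesis .
    qed
    then show "\<exists>N. \<forall>n\<ge>N. norm ((\<Sum>i<Suc n. w (r n (Suc i)) * (f (r n (Suc i)) - f (r n i))) - G b) < e"
      by (auto simp del: sum.lessThan_Suc)
  qed
  then have "(\<lambda>n. f b * w b - f a * w a - (\<Sum>i<Suc n. w (r n (Suc i)) * (f (r n (Suc i)) - f (r n i))))
      \<longlonglongrightarrow> f b * w b - f a * w a - G b"
    by (intro tendsto_intros)
  moreover have "(\<Sum>i<Suc n. f (r n i) * (w (r n (Suc i)) - w (r n i))) =
      f b * w b - f a * w a - (\<Sum>i<Suc n. w (r n (Suc i)) * (f (r n (Suc i)) - f (r n i)))" for n
    using summation_by_parts[of "\<lambda>i. f (r n i)" "\<lambda>i. w (r n i)" "Suc n"]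
    by (simp only: r_def grid_point_0 grid_point_Suc_n)
  ultimately show ?thesis
    by (simp only: r_def G_def)
qed

context two_sided_brownian_motion
begin

text \<open>The Riemann step functions of \<open>f\<close> converge to \<open>f\<close> in \<open>L\<^sup>2\<close>, so their integrals converge to
  \<open>X\<close> in mean square, while along each continuous path the same sums converge to the right-hand
  side.\<close>

lemma wiener_integral_by_parts:
  assumes "a < b" and X: "has_wiener_integral M W {a..b} f X"
    and df: "\<And>x. x \<in> {a..b} \<Longrightarrow> (f has_real_derivative f' x) (at x within {a..b})"
    and cf': "continuous_on {a..b} f'"
  shows "AE \<omega> in M. X \<omega> = f b * W b \<omega> - f a * W a \<omega> - integral {a..b} (\<lambda>x. f' x * W x \<omega>)"
proof (rule wiener_integral_eq_pathwise_limit[OF X])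
  show "step_rep (riemann_steps f a b n)" for n
    using assms(1) by (intro step_rep_riemann_steps) simp
  obtain B where B: "\<And>x. x \<in> {a..b} \<Longrightarrow> \<bar>f' x\<bar> \<le> B" "B > 0"
    using continuous_on_Icc_bounded[OF cf'] by blast
  have "\<bar>f x - f y\<bar> \<le> B * \<bar>x - y\<bar>" if "x \<in> {a..b}" "y \<in> {a..b}" for x y
    using field_differentiable_bound[OF _ df _ that(2) that(1), of B] B(1) that
    by (simp add: abs_minus_commute)
  then show "(\<lambda>n. \<integral>\<^sup>+ u. ennreal ((indicator {a..b} u * f u -
      step_fun (riemann_steps f a b n) u)\<^sup>2) \<partial>lborel) \<longlonglongrightarrow> 0"
    using assms(1) B(2) by (intro riemann_steps_tendsto_L2) auto
  show "AE \<omega> in M. (\<lambda>n. step_integral W (riemann_steps f a b n) \<omega>) \<longlonglongrightarrow>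
      f b * W b \<omega> - f a * W a \<omega> - integral {a..b} (\<lambda>x. f' x * W x \<omega>)"
    using continuous_paths
  proof eventually_elim
    case (elim \<omega>)
    show ?case unfolding step_integral_riemann_steps
      by (rule riemann_stieltjes_integration_by_parts[OF assms(1) df cf'])
        (use elim continuous_on_subset in auto)
  qed
qed

end

section \<open>A weighted integral of the Brownian path\<close>

context two_sided_brownian_motion
begin

text \<open>Since \<open>W 0 = 0\<close> almost surely, \<open>W r\<close> has second moment \<open>\<bar>r\<bar>\<close>; the bound
  \<open>2 \<bar>w\<bar> \<le> s + w\<^sup>2 / s\<close> with \<open>s = sqrt \<bar>r\<bar>\<close> turns this into a first moment.\<close>

lemma first_absolute_moment:
  "(\<integral>\<^sup>+ \<omega>. ennreal \<bar>W r \<omega>\<bar> \<partial>M) \<le> ennreal (sqrt \<bar>r\<bar>)"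
proof (cases "r = 0")
  case True
  have "(\<integral>\<^sup>+ \<omega>. ennreal \<bar>W 0 \<omega>\<bar> \<partial>M) = 0"
    using W_zero by (subst nn_integral_0_iff_AE) auto
  with True show ?thesis by simp
next
  case False
  define s where "s = sqrt \<bar>r\<bar>"
  have "s > 0" and s2: "s * s = \<bar>r\<bar>" using False by (auto simp: s_def)
  have amgm: "\<bar>w\<bar> \<le> (s + w\<^sup>2 / s) / 2" for w
    using zero_le_power2[of "\<bar>w\<bar> - s"] \<open>s > 0\<close> by (simp add: power2_eq_square field_simps)
  have I: "has_bochner_integral M (\<lambda>\<omega>. (s + (W r \<omega> - W 0 \<omega>)\<^sup>2 / s) / 2) ((s + \<bar>r - 0\<bar> / s) / 2)"
    by (intro has_bochner_integral_divide_zero has_bochner_integral_add second_moment_increment)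
      (simp add: has_bochner_integral_iff prob_space)
  have "(\<integral>\<^sup>+ \<omega>. ennreal \<bar>W r \<omega>\<bar> \<partial>M) \<le> (\<integral>\<^sup>+ \<omega>. ennreal ((s + (W r \<omega> - W 0 \<omega>)\<^sup>2 / s) / 2) \<partial>M)"
  proof (rule nn_integral_mono_AE)
    show "AE \<omega> in M. ennreal \<bar>W r \<omega>\<bar> \<le> ennreal ((s + (W r \<omega> - W 0 \<omega>)\<^sup>2 / s) / 2)"
      using W_zero
    proof eventually_elim
      case (elim \<omega>)
      show ?case unfolding elim using amgm[of "W r \<omega>"] by (intro ennreal_leI) simp
    qed
  qed
  also have "\<dots> = ennreal ((s + \<bar>r - 0\<bar> / s) / 2)"
    using I \<open>s > 0\<close> by (subst nn_integral_eq_integral) (auto simp: has_bochner_integral_iff)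
  also have "(s + \<bar>r - 0\<bar> / s) / 2 = s"
    using s2 \<open>s > 0\<close> by (simp add: field_simps)
  finally show ?thesis by (simp add: s_def)
qed

text \<open>The set of continuous paths has full measure but may fail to be measurable; changing \<open>W\<close> on a
  measurable null set makes every path continuous, as joint measurability in time and chance
  requires.\<close>

lemma continuous_modification:
  "\<exists>V. (\<forall>\<omega>\<in>space M. continuous_on UNIV (\<lambda>t. V t \<omega>)) \<and> (\<forall>t. V t \<in> borel_measurable M) \<and>
     (AE \<omega> in M. \<forall>t. V t \<omega> = W t \<omega>)"
proof -
  from continuous_paths obtain N where
    N: "{\<omega> \<in> space M. \<not> continuous_on UNIV (\<lambda>t. W t \<omega>)} \<subseteq> N" "N \<in> null_sets M"
    by (auto elim!: AE_E simp: null_sets_def)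
  note [measurable] = null_setsD2[OF N(2)]
  show ?thesis
  proof (intro exI[of _ "\<lambda>t \<omega>. if \<omega> \<in> N then 0 else W t \<omega>"] conjI allI ballI)
    show "continuous_on UNIV (\<lambda>t. if \<omega> \<in> N then 0 else W t \<omega>)" if "\<omega> \<in> space M" for \<omega>
      using N(1) that by (cases "\<omega> \<in> N") auto
    show "(\<lambda>\<omega>. if \<omega> \<in> N then 0 else W t \<omega>) \<in> borel_measurable M" for t
      by measurable
    show "AE \<omega> in M. \<forall>t. (if \<omega> \<in> N then 0 else W t \<omega>) = W t \<omega>"
      using AE_not_in[OF N(2)] by eventually_elim auto
  qed
qed

end

text \<open>A continuous path is the limit of its values at the grid of mesh \<open>1 / (n + 1)\<close>, and for each fixed
  \<open>n\<close> only countably many times occur.\<close>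

lemma measurable_pair_of_continuous_paths:
  fixes V :: "real \<Rightarrow> 'a \<Rightarrow> real"
  assumes cont: "\<And>\<omega>. \<omega> \<in> space N \<Longrightarrow> continuous_on UNIV (\<lambda>t. V t \<omega>)"
    and [measurable]: "\<And>t. V t \<in> borel_measurable N"
  shows "(\<lambda>x. V (snd x) (fst x)) \<in> borel_measurable (N \<Otimes>\<^sub>M borel)"
proof (rule borel_measurable_LIMSEQ_real)
  fix n :: nat
  show "(\<lambda>x. V (real_of_int \<lfloor>real (Suc n) * snd x\<rfloor> / real (Suc n)) (fst x))
      \<in> borel_measurable (N \<Otimes>\<^sub>M borel)"
    by (rule measurable_compose_countable[where f = "\<lambda>i x. V (real_of_int i / real (Suc n)) (fst x)"
          and g = "\<lambda>x. \<lfloor>real (Suc n) * snd x\<rfloor>"]) measurable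
next
  fix x assume "x \<in> space (N \<Otimes>\<^sub>M (borel :: real measure))"
  then have "fst x \<in> space N" by (auto simp: space_pair_measure)
  from cont[OF this] have "isCont (\<lambda>t. V t (fst x)) (snd x)"
    by (simp add: continuous_on_eq_continuous_at)
  moreover have "(\<lambda>n. real_of_int \<lfloor>real (Suc n) * snd x\<rfloor> / real (Suc n)) \<longlonglongrightarrow> snd x"
  proof (rule tendsto_sandwich[where f = "\<lambda>n. snd x - 1 / real (Suc n)" and h = "\<lambda>n. snd x"])
    show "(\<lambda>n. snd x - 1 / real (Suc n)) \<longlonglongrightarrow> snd x"
      using tendsto_diff[OF tendsto_const tendsto_grid_mesh[of 1], of "snd x"] by simp
    have "snd x - 1 / real (Suc n) \<le> real_of_int \<lfloor>real (Suc n) * snd x\<rfloor> / real (Suc n)" for n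
    proof -
      have "real (Suc n) * snd x - 1 \<le> real_of_int \<lfloor>real (Suc n) * snd x\<rfloor>" by linarith
      from divide_right_mono[OF this, of "real (Suc n)"] show ?thesis
        by (simp add: diff_divide_distrib del: of_nat_Suc)
    qed
    then show "\<forall>\<^sub>F n in sequentially.
        snd x - 1 / real (Suc n) \<le> real_of_int \<lfloor>real (Suc n) * snd x\<rfloor> / real (Suc n)"
      by (simp del: of_nat_Suc)
    have "real_of_int \<lfloor>real (Suc n) * snd x\<rfloor> / real (Suc n) \<le> snd x" for n
    proof -
      have "real_of_int \<lfloor>real (Suc n) * snd x\<rfloor> \<le> real (Suc n) * snd x" by linarith
      from divide_right_mono[OF this, of "real (Suc n)"] show ?thesis
        by (simp del: of_nat_Suc)
    qed
    then show "\<forall>\<^sub>F n in sequentially. real_of_int \<lfloor>real (Suc n) * snd x\<rfloor> / real (Suc n) \<le> snd x"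
      by (simp del: of_nat_Suc)
  qed simp
  ultimately show "(\<lambda>n. V (real_of_int \<lfloor>real (Suc n) * snd x\<rfloor> / real (Suc n)) (fst x))
      \<longlonglongrightarrow> V (snd x) (fst x)"
    by (rule isCont_tendsto_compose)
qed

lemma nn_integral_abs_powr_finite:
  assumes "q > -1" "c \<ge> 0"
  shows "(\<integral>\<^sup>+ r. ennreal (indicator {-c..0} r * \<bar>r\<bar> powr q) \<partial>lborel) < \<infinity>"
proof -
  have "((\<lambda>r. (- r) powr q) has_integral (c powr (q + 1) / (q + 1))) {-c..-0}"
    using has_integral_powr_from_0[OF assms] by (subst has_integral_reflect_real)
  then have "((\<lambda>r. \<bar>r\<bar> powr q) has_integral (c powr (q + 1) / (q + 1))) {-c..0}"
    by (subst has_integral_cong[where g = "\<lambda>r. (- r) powr q"]) auto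
  from nn_integral_has_integral_lebesgue[OF _ this] show ?thesis by simp
qed

context two_sided_brownian_motion
begin

text \<open>By Tonelli's theorem the expectation of the integral is at most the integral of \<open>\<bar>r\<bar> powr (q + 1/2)\<close>,
  which converges at \<open>0\<close> exactly for \<open>q > -3/2\<close>. This is the quantitative form in which the
  regularity of \<open>W\<close> at time \<open>0\<close> is used.\<close>

lemma AE_weighted_path_integral_finite:
  assumes "q > -3/2" "c \<ge> 0"
  shows "AE \<omega> in M. (\<integral>\<^sup>+ r. ennreal (indicator {-c..0} r * \<bar>r\<bar> powr q * \<bar>W r \<omega>\<bar>) \<partial>lborel) < \<infinity>"
proof -
  obtain V where V: "\<And>\<omega>. \<omega> \<in> space M \<Longrightarrow> continuous_on UNIV (\<lambda>t. V t \<omega>)"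
      "\<And>t. V t \<in> borel_measurable M" "AE \<omega> in M. \<forall>t. V t \<omega> = W t \<omega>"
    using continuous_modification by blast
  note [measurable] = measurable_pair_of_continuous_paths[OF V(1,2)] V(2)
  interpret P: pair_sigma_finite M lborel ..
  let ?w = "\<lambda>r :: real. indicator {-c..0} r * \<bar>r\<bar> powr q :: real"
  have V_joint [measurable]:
    "(\<lambda>(\<omega>, r). ennreal (?w r * \<bar>V r \<omega>\<bar>)) \<in> borel_measurable (M \<Otimes>\<^sub>M lborel)"
    unfolding case_prod_beta by measurable
  have moment: "(\<integral>\<^sup>+ \<omega>. ennreal (?w r * \<bar>V r \<omega>\<bar>) \<partial>M) \<le>
      ennreal (indicator {-c..0} r * \<bar>r\<bar> powr (q + 1/2))" for r
  proof -
    have "(\<integral>\<^sup>+ \<omega>. ennreal (?w r * \<bar>V r \<omega>\<bar>) \<partial>M) = ennreal (?w r) * (\<integral>\<^sup>+ \<omega>. ennreal \<bar>V r \<omega>\<bar> \<partial>M)"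
      by (simp add: ennreal_mult nn_integral_cmult)
    also have "(\<integral>\<^sup>+ \<omega>. ennreal \<bar>V r \<omega>\<bar> \<partial>M) = (\<integral>\<^sup>+ \<omega>. ennreal \<bar>W r \<omega>\<bar> \<partial>M)"
      using V(3) by (intro nn_integral_cong_AE) (auto elim!: eventually_mono)
    also have "ennreal (?w r) * \<dots> \<le> ennreal (?w r) * ennreal (sqrt \<bar>r\<bar>)"
      by (intro mult_left_mono first_absolute_moment) simp
    also have "\<dots> = ennreal (indicator {-c..0} r * \<bar>r\<bar> powr (q + 1/2))"
      by (simp add: powr_add powr_half_sqrt flip: ennreal_mult)
    finally show ?thesis .
  qed
  have "(\<integral>\<^sup>+ \<omega>. (\<integral>\<^sup>+ r. ennreal (?w r * \<bar>V r \<omega>\<bar>) \<partial>lborel) \<partial>M) =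
      (\<integral>\<^sup>+ r. (\<integral>\<^sup>+ \<omega>. ennreal (?w r * \<bar>V r \<omega>\<bar>) \<partial>M) \<partial>lborel)"
    using P.Fubini'[of "\<lambda>\<omega> r. ennreal (?w r * \<bar>V r \<omega>\<bar>)"] V_joint by simp
  also have "\<dots> \<le> (\<integral>\<^sup>+ r. ennreal (indicator {-c..0} r * \<bar>r\<bar> powr (q + 1/2)) \<partial>lborel)"
    by (intro nn_integral_mono moment)
  also have "\<dots> < \<infinity>"
    using assms by (intro nn_integral_abs_powr_finite) auto
  finally have "AE \<omega> in M. (\<integral>\<^sup>+ r. ennreal (?w r * \<bar>V r \<omega>\<bar>) \<partial>lborel) \<noteq> \<infinity>"
    by (intro nn_integral_PInf_AE) (use V_joint in measurable)
  with V(3) show ?thesis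
    by eventually_elim (simp add: less_top)
qed

end

section \<open>Estimates for the kernel\<close>

lemma rl_kernel_deriv:
  assumes "u > 0"
  shows "deriv (rl_kernel H) u = (H - 1/2) * u powr (H - 3/2)"
proof -
  have "deriv (rl_kernel H) u = deriv (\<lambda>u. u powr (H - 1/2)) u"
    using eventually_nhds_in_open[of "{0<..}" u] assms
    by (intro deriv_cong_ev) (auto elim!: eventually_mono simp: rl_kernel_def)
  also have "\<dots> = (H - 1/2) * u powr (H - 1/2 - 1)"
    using assms by (intro DERIV_imp_deriv) (auto intro!: derivative_eq_intros)
  finally show ?thesis by simp
qed

lemma rl_kernel_deriv2:
  assumes "u > 0"
  shows "deriv (deriv (rl_kernel H)) u = (H - 1/2) * (H - 3/2) * u powr (H - 5/2)"
proof -
  have "deriv (deriv (rl_kernel H)) u = deriv (\<lambda>u. (H - 1/2) * u powr (H - 3/2)) u"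
    using eventually_nhds_in_open[of "{0<..}" u] assms
    by (intro deriv_cong_ev) (auto elim!: eventually_mono simp: rl_kernel_deriv)
  also have "\<dots> = (H - 1/2) * ((H - 3/2) * u powr (H - 3/2 - 1))"
    using assms by (intro DERIV_imp_deriv) (auto intro!: derivative_eq_intros)
  finally show ?thesis by simp
qed

lemma modified_kernel_has_derivatives:
  assumes "modified_kernel H T K" "u \<noteq> 0"
  shows "((deriv ^^ k) K has_real_derivative (deriv ^^ Suc k) K u) (at u)"
proof -
  have "(deriv ^^ k) K differentiable_on - {0}"
    using assms(1) by (auto simp: modified_kernel_def)
  then have "(deriv ^^ k) K differentiable (at u)"
    using assms(2) by (simp add: differentiable_on_eq_differentiable_at open_Compl)
  then show ?thesis
    by (simp add: DERIV_deriv_iff_real_differentiable)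
qed

lemma continuous_on_modified_kernel_deriv:
  assumes "modified_kernel H T K" "v > 0"
  shows "continuous_on {..0} (\<lambda>r. (deriv ^^ k) K (v - r))"
proof (rule continuous_on_compose2[of "{0<..}" "(deriv ^^ k) K"])
  show "continuous_on {0<..} ((deriv ^^ k) K)"
    by (rule DERIV_continuous_on, rule has_field_derivative_at_within,
        rule modified_kernel_has_derivatives[OF assms(1)]) auto
qed (use assms(2) in \<open>auto intro!: continuous_intros\<close>)

lemma modified_kernel_vanishes:
  assumes "modified_kernel H T K" "u \<noteq> 0" "u < 0 \<or> u > 2 * T"
  shows "K u = 0"
proof (rule ccontr)
  assume "K u \<noteq> 0"
  then have "u \<in> closure {u. u \<noteq> 0 \<and> K u \<noteq> 0}"
    using assms(2) by (auto intro: closure_subset[THEN subsetD])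
  moreover have "closure {u. u \<noteq> 0 \<and> K u \<noteq> 0} \<subseteq> {0..2 * T}"
    using assms(1) unfolding modified_kernel_def by (elim conjE)
  ultimately show False
    using assms(3) by auto
qed

lemma modified_kernel_deriv2_bound:
  assumes "modified_kernel H T K"
  obtains C where "C > 0" "\<And>u. u > 0 \<Longrightarrow> \<bar>deriv (deriv K) u\<bar> \<le> C * u powr (H - 5/2)"
proof -
  from assms obtain C where C: "C > 0" "\<forall>k\<in>{0, 1, 2::nat}. \<forall>u. u \<noteq> 0 \<longrightarrow>
      \<bar>(deriv ^^ k) K u\<bar> \<le> C * \<bar>(deriv ^^ k) (rl_kernel H) u\<bar>"
    unfolding modified_kernel_def by (elim conjE exE) (rule that)
  define D where "D = C * \<bar>(H - 1/2) * (H - 3/2)\<bar> + 1"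
  show ?thesis
  proof
    show "D > 0" using C(1) by (simp add: D_def add_nonneg_pos)
    fix u :: real assume "u > 0"
    have "\<bar>deriv (deriv K) u\<bar> \<le> C * \<bar>deriv (deriv (rl_kernel H)) u\<bar>"
      using C(2)[THEN bspec, of 2] \<open>u > 0\<close> by (simp add: numeral_2_eq_2)
    also have "\<dots> = (C * \<bar>(H - 1/2) * (H - 3/2)\<bar>) * u powr (H - 5/2)"
      using \<open>u > 0\<close> by (simp add: rl_kernel_deriv2 abs_mult)
    also have "\<dots> \<le> D * u powr (H - 5/2)"
      by (intro mult_right_mono) (auto simp: D_def)
    finally show "\<bar>deriv (deriv K) u\<bar> \<le> D * u powr (H - 5/2)" .
  qed
qed

text \<open>The exponent in the bound on \<open>K''\<close> is split into \<open>\<eta> - 1\<close> and \<open>q\<close> so that \<open>u\<close> and the time variable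
  separate: \<open>(r + u) powr (\<eta> - 1 + q) \<le> r powr (\<eta> - 1) * u powr q\<close>. For \<open>r > s\<close> moreover
  \<open>r powr (\<eta> - 1) \<le> s powr (\<eta> - \<theta>) * (r - s) powr (\<theta> - 1)\<close>, and the right-hand side is, up to the
  factor \<open>\<theta>\<close>, the derivative of \<open>s powr (\<eta> - \<theta>) * (r - s) powr \<theta>\<close>. This covers both
  \<open>t - s \<le> s\<close> and \<open>t - s > s\<close> at once.\<close>

lemma deriv_kernel_increment_bound:
  assumes K: "\<And>u. u > 0 \<Longrightarrow> (K' has_real_derivative K'' u) (at u)"
    and bound: "\<And>u. u > 0 \<Longrightarrow> \<bar>K'' u\<bar> \<le> C * u powr (\<eta> - 1 + q)" and "C > 0"
    and "\<eta> \<le> \<theta>" "0 < \<theta>" "\<theta> < 1" "q \<le> 0"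
    and "0 < s" "s < t" "0 < u"
  shows "\<bar>K' (t + u) - K' (s + u)\<bar> \<le> C / \<theta> * u powr q * s powr (\<eta> - \<theta>) * (t - s) powr \<theta>"
proof -
  define A where "A = C * u powr q * s powr (\<eta> - \<theta>)"
  have "norm (K' (t + u) - K' (s + u)) \<le> A / \<theta> * (t - s) powr \<theta> - A / \<theta> * (s - s) powr \<theta>"
  proof (rule differentiable_bound_general[OF \<open>s < t\<close>, where f' = "\<lambda>r. K'' (r + u)"
        and \<phi>' = "\<lambda>r. A * (r - s) powr (\<theta> - 1)"])
    have dK: "((\<lambda>r. K' (r + u)) has_real_derivative K'' (r + u)) (at r)" if "r \<ge> s" for r
      using K[of "r + u"] that assms by (simp add: DERIV_shift)
    show "continuous_on {s..t} (\<lambda>r. K' (r + u))"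
      by (rule DERIV_continuous_on) (auto intro: dK has_field_derivative_at_within)
    show "continuous_on {s..t} (\<lambda>r. A / \<theta> * (r - s) powr \<theta>)"
      using \<open>0 < \<theta>\<close> by (intro continuous_intros continuous_on_powr') auto
    fix r assume r: "s < r" "r < t"
    show "((\<lambda>r. K' (r + u)) has_vector_derivative K'' (r + u)) (at r)"
      using dK[of r] r by (simp add: has_real_derivative_iff_has_vector_derivative)
    show "((\<lambda>r. A / \<theta> * (r - s) powr \<theta>) has_vector_derivative A * (r - s) powr (\<theta> - 1)) (at r)"
      unfolding has_real_derivative_iff_has_vector_derivative[symmetric]
      using r \<open>0 < \<theta>\<close> by (auto intro!: derivative_eq_intros)
    have "norm (K'' (r + u)) \<le> C * ((r + u) powr (\<eta> - 1) * (r + u) powr q)"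
      using bound[of "r + u"] r assms by (simp add: powr_add)
    also have "\<dots> \<le> C * (r powr (\<eta> - 1) * u powr q)"
      using r assms by (intro mult_left_mono mult_mono powr_mono2') auto
    also have "r powr (\<eta> - 1) = r powr (\<eta> - \<theta>) * r powr (\<theta> - 1)"
      by (simp flip: powr_add)
    also have "C * (r powr (\<eta> - \<theta>) * r powr (\<theta> - 1) * u powr q)
        \<le> C * (s powr (\<eta> - \<theta>) * (r - s) powr (\<theta> - 1) * u powr q)"
      using r assms by (intro mult_left_mono mult_right_mono mult_mono powr_mono2') auto
    finally show "norm (K'' (r + u)) \<le> A * (r - s) powr (\<theta> - 1)"
      by (simp add: A_def mult_ac)
  qed
  then show ?thesis
    using assms by (simp add: A_def)
qed

section \<open>The difference of the two processes\<close>

lemma continuous_extension_of_bound: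
  fixes D :: "real \<Rightarrow> real"
  assumes cont: "continuous_on {0<..T} D"
    and bound: "\<And>s t. s \<in> \<rat> \<Longrightarrow> t \<in> \<rat> \<Longrightarrow> 0 < s \<Longrightarrow> s < t \<Longrightarrow> t \<le> T \<Longrightarrow>
        \<bar>D t - D s\<bar> \<le> B * s powr a * (t - s) powr b"
    and "0 < s" "s < t" "t \<le> T"
  shows "\<bar>D t - D s\<bar> \<le> B * s powr a * (t - s) powr b"
proof -
  \<comment> \<open>The denominators start at \<open>2\<close>, which separates the approximations of \<open>s\<close> and \<open>t\<close>.\<close>
  define \<delta> where "\<delta> n = (t - s) / real (Suc (Suc n))" for n
  have \<delta>: "0 < \<delta> n" "2 * \<delta> n \<le> t - s" for n
    using \<open>s < t\<close> by (auto simp: \<delta>_def field_simps intro: mult_right_mono)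
  have "\<delta> \<longlonglongrightarrow> 0"
    unfolding \<delta>_def using LIMSEQ_Suc[OF tendsto_grid_mesh[of "t - s"]] .
  have "\<exists>p\<in>\<rat>. s < p \<and> p < s + \<delta> n" "\<exists>p\<in>\<rat>. t - \<delta> n < p \<and> p < t" for n
    using Rats_dense_in_real[of s "s + \<delta> n"] Rats_dense_in_real[of "t - \<delta> n" t] \<delta>[of n] by auto
  then obtain p q where p: "\<And>n. p n \<in> \<rat>" "\<And>n. s < p n" "\<And>n. p n < s + \<delta> n"
    and q: "\<And>n. q n \<in> \<rat>" "\<And>n. t - \<delta> n < q n" "\<And>n. q n < t"
    by metis
  have limp: "p \<longlonglongrightarrow> s"
  proof (rule tendsto_sandwich[OF _ _ tendsto_const])
    show "(\<lambda>n. s + \<delta> n) \<longlonglongrightarrow> s" using tendsto_add[OF tendsto_const \<open>\<delta> \<longlonglongrightarrow> 0\<close>, of s] by simp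
  qed (use p in \<open>auto intro!: always_eventually less_imp_le\<close>)
  have limq: "q \<longlonglongrightarrow> t"
  proof (rule tendsto_sandwich[OF _ _ _ tendsto_const])
    show "(\<lambda>n. t - \<delta> n) \<longlonglongrightarrow> t" using tendsto_diff[OF tendsto_const \<open>\<delta> \<longlonglongrightarrow> 0\<close>, of t] by simp
  qed (use q in \<open>auto intro!: always_eventually less_imp_le\<close>)
  have pq: "0 < p n" "p n < q n" "q n \<le> T" for n
    using p(2,3)[of n] q(2,3)[of n] \<delta>[of n] assms(3-5) by linarith+
  have Dp: "(\<lambda>n. D (p n)) \<longlonglongrightarrow> D s"
    using pq(1) less_imp_le[OF less_le_trans[OF pq(2,3)]] assms
    by (intro continuous_on_tendsto_compose[OF cont limp]) auto
  have Dq: "(\<lambda>n. D (q n)) \<longlonglongrightarrow> D t"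
    using less_trans[OF pq(1,2)] pq(3) assms
    by (intro continuous_on_tendsto_compose[OF cont limq]) auto
  show ?thesis
  proof (rule LIMSEQ_le)
    show "(\<lambda>n. \<bar>D (q n) - D (p n)\<bar>) \<longlonglongrightarrow> \<bar>D t - D s\<bar>"
      by (intro tendsto_intros Dp Dq)
    show "(\<lambda>n. B * p n powr a * (q n - p n) powr b) \<longlonglongrightarrow> B * s powr a * (t - s) powr b"
      using assms by (intro tendsto_intros limp limq) auto
    show "\<exists>N. \<forall>n\<ge>N. \<bar>D (q n) - D (p n)\<bar> \<le> B * p n powr a * (q n - p n) powr b"
      using bound[OF p(1) q(1) pq] by blast
  qed
qed

lemma abs_integral_le_weighted:
  fixes g w :: "real \<Rightarrow> real"
  assumes cont: "continuous_on {a..b} (\<lambda>r. g r * w r)"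
    and bound: "\<And>r. r \<in> {a..b} \<Longrightarrow> r \<noteq> 0 \<Longrightarrow> \<bar>g r\<bar> \<le> B * \<bar>r\<bar> powr q" and "B \<ge> 0"
    and [measurable]: "w \<in> borel_measurable borel"
    and fin: "(\<integral>\<^sup>+ r. ennreal (indicator {a..b} r * \<bar>r\<bar> powr q * \<bar>w r\<bar>) \<partial>lborel) < \<infinity>"
  shows "\<bar>integral {a..b} (\<lambda>r. g r * w r)\<bar> \<le>
    B * enn2real (\<integral>\<^sup>+ r. ennreal (indicator {a..b} r * \<bar>r\<bar> powr q * \<bar>w r\<bar>) \<partial>lborel)"
proof -
  let ?A = "\<integral>\<^sup>+ r. ennreal (indicator {a..b} r * \<bar>r\<bar> powr q * \<bar>w r\<bar>) \<partial>lborel"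
  have int: "set_integrable lborel {a..b} (\<lambda>r. g r * w r)"
    by (rule borel_integrable_atLeastAtMost'[OF cont])
  have "ennreal \<bar>integral {a..b} (\<lambda>r. g r * w r)\<bar> = ennreal (norm (LINT r:{a..b}|lborel. g r * w r))"
    using set_borel_integral_eq_integral(2)[OF int] by simp
  also have "\<dots> \<le> (\<integral>\<^sup>+ r. ennreal (norm (indicator {a..b} r *\<^sub>R (g r * w r))) \<partial>lborel)"
    using int unfolding set_lebesgue_integral_def set_integrable_def
    by (rule integral_norm_bound_ennreal)
  also have "\<dots> \<le> (\<integral>\<^sup>+ r. ennreal B * ennreal (indicator {a..b} r * \<bar>r\<bar> powr q * \<bar>w r\<bar>) \<partial>lborel)"
  proof (rule nn_integral_mono_AE)
    show "AE r in lborel. ennreal (norm (indicator {a..b} r *\<^sub>R (g r * w r))) \<le>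
        ennreal B * ennreal (indicator {a..b} r * \<bar>r\<bar> powr q * \<bar>w r\<bar>)"
      using AE_lborel_singleton[of 0]
    proof eventually_elim
      case (elim r)
      have "\<bar>g r\<bar> * \<bar>w r\<bar> \<le> B * \<bar>r\<bar> powr q * \<bar>w r\<bar>" if "r \<in> {a..b}"
        using bound[OF that elim] by (rule mult_right_mono) simp
      then show ?case
        using \<open>B \<ge> 0\<close> by (auto simp: indicator_def abs_mult mult.assoc simp flip: ennreal_mult intro!: ennreal_leI)
    qed
  qed
  also have "\<dots> = ennreal B * ?A"
    by (rule nn_integral_cmult) measurable
  also have "\<dots> = ennreal (B * enn2real ?A)"
    using fin \<open>B \<ge> 0\<close> by (simp add: ennreal_mult)
  finally show ?thesis
    using \<open>B \<ge> 0\<close> by (simp add: enn2real_nonneg)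
qed

context two_sided_brownian_motion
begin

text \<open>For \<open>0 < r < t\<close> the argument \<open>t - r\<close> lies in \<open>(0, T]\<close>, where the two kernels coincide, so the
  integrals over \<open>[0, t]\<close> cancel and only the past of \<open>W\<close> before time \<open>0\<close> remains; by the support
  of \<open>K\<close> it may be cut off at \<open>-2 T\<close>.\<close>

lemma stationary_minus_rl_wiener:
  assumes "T > 0"
    and K: "modified_kernel H T K"
    and WH: "rl_process M W H WH" and What: "stationary_process M W K What"
    and t: "0 < t" "t \<le> T"
  shows "has_wiener_integral M W {-2 * T..0} (\<lambda>r. K (t - r)) (\<lambda>\<omega>. What t \<omega> - WH t \<omega>)"
proof (rule has_wiener_integral_cong_AE)
  show "has_wiener_integral M W UNIV
      (\<lambda>u. indicator {..t} u * K (t - u) - indicator {0..t} u * rl_kernel H (t - u))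
      (\<lambda>\<omega>. What t \<omega> - WH t \<omega>)"
    using WH What t
    by (intro has_wiener_integral_diff) (auto simp: rl_process_def stationary_process_def)
  have "continuous_on {-2 * T..0} (\<lambda>r. K (t - r))"
    using continuous_on_modified_kernel_deriv[OF K \<open>0 < t\<close>, of 0]
    by (auto intro: continuous_on_subset)
  from borel_measurable_continuous_on_indicator[OF _ this]
  show "(\<lambda>u. indicator {-2 * T..0} u * K (t - u)) \<in> borel_measurable borel"
    by simp
  show "AE u in lborel. indicator UNIV u *
      (indicator {..t} u * K (t - u) - indicator {0..t} u * rl_kernel H (t - u))
      = indicator {-2 * T..0} u * K (t - u)"
    \<comment> \<open>At \<open>u = t\<close> the value \<open>K 0\<close> is arbitrary, and at \<open>u = 0\<close> the two sides differ by \<open>K t\<close>.\<close>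
    using AE_lborel_singleton[of 0] AE_lborel_singleton[of t]
  proof eventually_elim
    case (elim u)
    consider "u < -2 * T" | "-2 * T \<le> u" "u < 0" | "0 < u" "u < t" | "t < u"
      using elim by linarith
    then show ?case
    proof cases
      case 1
      then have "K (t - u) = 0"
        using t \<open>T > 0\<close> by (intro modified_kernel_vanishes[OF K]) auto
      with 1 show ?thesis using t \<open>T > 0\<close> by simp
    next
      case 3
      then have "K (t - u) = rl_kernel H (t - u)"
        using K t by (auto simp: modified_kernel_def)
      with 3 show ?thesis by simp
    qed (use t in auto)
  qed
qed

text \<open>Both boundary terms vanish: \<open>W 0 = 0\<close> almost surely, and \<open>K (t + 2 T) = K (s + 2 T) = 0\<close>.\<close>

lemma stationary_minus_rl_increment:
  assumes "T > 0"
    and K: "modified_kernel H T K"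
    and WH: "rl_process M W H WH" and What: "stationary_process M W K What"
    and st: "0 < s" "s < t" "t \<le> T"
  shows "AE \<omega> in M. (What t \<omega> - WH t \<omega>) - (What s \<omega> - WH s \<omega>) =
     integral {-2 * T..0} (\<lambda>r. (deriv K (t - r) - deriv K (s - r)) * W r \<omega>)"
proof -
  let ?f = "\<lambda>r. K (t - r) - K (s - r)"
  let ?X = "\<lambda>\<omega>. (What t \<omega> - WH t \<omega>) - (What s \<omega> - WH s \<omega>)"
  let ?f' = "\<lambda>r. - (deriv K (t - r) - deriv K (s - r))"
  have dK: "(K has_real_derivative deriv K u) (at u)" if "u \<noteq> 0" for u
    using modified_kernel_has_derivatives[OF K that, of 0] by simp
  have df: "(?f has_real_derivative ?f' r) (at r within {-2 * T..0})" if "r \<in> {-2 * T..0}" for r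
    using that st
    by (auto intro!: derivative_eq_intros DERIV_chain2[OF dK, of "\<lambda>r. _ - r"])
  have cf': "continuous_on {-2 * T..0} ?f'"
  proof -
    have *: "continuous_on {-2 * T..0} (\<lambda>r. deriv K (v - r))" if "v > 0" for v
      using continuous_on_modified_kernel_deriv[OF K that, of 1]
      by (auto intro: continuous_on_subset)
    show ?thesis using st by (intro continuous_intros *) auto
  qed
  have "has_wiener_integral M W {-2 * T..0} ?f ?X"
  proof (rule has_wiener_integral_cong_AE)
    show "has_wiener_integral M W UNIV
      (\<lambda>u. indicator {-2 * T..0} u * K (t - u) - indicator {-2 * T..0} u * K (s - u)) ?X"
      using st by (intro has_wiener_integral_diff
          stationary_minus_rl_wiener[OF \<open>T > 0\<close> K WH What]) auto
    have "continuous_on {-2 * T..0} ?f"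
      by (rule DERIV_continuous_on) (rule df)
    from borel_measurable_continuous_on_indicator[OF _ this]
    show "(\<lambda>u. indicator {-2 * T..0} u * ?f u) \<in> borel_measurable borel"
      by simp
  qed (simp add: algebra_simps)
  from wiener_integral_by_parts[OF _ this df cf'] have
    "AE \<omega> in M. ?X \<omega> = ?f 0 * W 0 \<omega> - ?f (-2 * T) * W (-2 * T) \<omega>
       - integral {-2 * T..0} (\<lambda>r. ?f' r * W r \<omega>)"
    using \<open>T > 0\<close> by simp
  then show ?thesis
    using W_zero
  proof eventually_elim
    case (elim \<omega>)
    have "?f (-2 * T) = 0"
      using modified_kernel_vanishes[OF K, of "t - (-2 * T)"]
        modified_kernel_vanishes[OF K, of "s - (-2 * T)"] st \<open>T > 0\<close> by simp
    with elim have "?X \<omega> = - integral {-2 * T..0} (\<lambda>r. ?f' r * W r \<omega>)" by simp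
    also have "\<dots> = integral {-2 * T..0} (\<lambda>r. - (?f' r * W r \<omega>))"
      by simp
    finally show ?case by (simp only: minus_mult_left minus_minus)
  qed
qed

text \<open>The identity for the increments holds almost surely for each single pair of times, hence
  simultaneously for all rational pairs; the estimate, whose constant is the same for all of
  them, then extends by continuity of the paths.\<close>

lemma remainder_bound_AE:
  assumes "T > 0"
    and K: "modified_kernel H T K"
    and WH: "rl_process M W H WH" and What: "stationary_process M W K What"
    and \<eta>: "H - 3/2 \<le> \<eta>" "\<eta> < H" and \<theta>: "0 < \<theta>" "\<theta> < 1" "\<eta> \<le> \<theta>"
  shows "AE \<omega> in M. \<exists>B\<ge>0. \<forall>s t. 0 < s \<longrightarrow> s < t \<longrightarrow> t \<le> T \<longrightarrow>
     \<bar>(What t \<omega> - WH t \<omega>) - (What s \<omega> - WH s \<omega>)\<bar> \<le> B * s powr (\<eta> - \<theta>) * (t - s) powr \<theta>"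
proof -
  \<comment> \<open>The condition \<open>\<eta> < H\<close> is \<open>q > -3/2\<close>, the integrability of the weight at \<open>0\<close>.\<close>
  define q where "q = H - \<eta> - 3/2"
  obtain C where C: "C > 0" "\<And>u. u > 0 \<Longrightarrow> \<bar>deriv (deriv K) u\<bar> \<le> C * u powr (H - 5/2)"
    using modified_kernel_deriv2_bound[OF K] by blast
  have ddK: "(deriv K has_real_derivative deriv (deriv K) u) (at u)" if "u > 0" for u
    using modified_kernel_has_derivatives[OF K, of u 1] that by simp
  have q: "-3/2 < q" "q \<le> 0" "\<eta> - 1 + q = H - 5/2"
    using \<eta> by (auto simp: q_def)
  have kernel: "\<bar>deriv K (t + u) - deriv K (s + u)\<bar> \<le>
      C / \<theta> * u powr q * s powr (\<eta> - \<theta>) * (t - s) powr \<theta>"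
    if "0 < s" "s < t" "0 < u" for s t u
    using that C q \<theta> by (intro deriv_kernel_increment_bound[OF ddK]) auto
  let ?A = "\<lambda>\<omega>. \<integral>\<^sup>+ r. ennreal (indicator {-2 * T..0} r * \<bar>r\<bar> powr q * \<bar>W r \<omega>\<bar>) \<partial>lborel"
  have A: "AE \<omega> in M. ?A \<omega> < \<infinity>"
    using AE_weighted_path_integral_finite[of q "2 * T"] q \<open>T > 0\<close> by simp
  have incr: "AE \<omega> in M. \<forall>st\<in>\<rat> \<times> \<rat>. 0 < fst st \<longrightarrow> fst st < snd st \<longrightarrow> snd st \<le> T \<longrightarrow>
      (What (snd st) \<omega> - WH (snd st) \<omega>) - (What (fst st) \<omega> - WH (fst st) \<omega>) =
      integral {-2 * T..0} (\<lambda>r. (deriv K (snd st - r) - deriv K (fst st - r)) * W r \<omega>)"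
    using stationary_minus_rl_increment[OF \<open>T > 0\<close> K WH What]
    by (subst AE_ball_countable) (auto simp: countable_rat intro!: countable_SIGMA)
  have contWH: "AE \<omega> in M. continuous_on {0..} (\<lambda>t. WH t \<omega>)"
    and contWhat: "AE \<omega> in M. continuous_on UNIV (\<lambda>t. What t \<omega>)"
    using WH What by (auto simp: rl_process_def stationary_process_def)
  show ?thesis
    using A incr contWH contWhat continuous_paths
  proof eventually_elim
    case (elim \<omega>)
    define D where "D t = What t \<omega> - WH t \<omega>" for t
    define B where "B = C / \<theta> * enn2real (?A \<omega>)"
    have "B \<ge> 0" using C(1) \<theta>(1) by (simp add: B_def enn2real_nonneg)
    have rational: "\<bar>D t - D s\<bar> \<le> B * s powr (\<eta> - \<theta>) * (t - s) powr \<theta>"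
      if "s \<in> \<rat>" "t \<in> \<rat>" and st: "0 < s" "s < t" "t \<le> T" for s t
    proof -
      define c where "c = C / \<theta> * s powr (\<eta> - \<theta>) * (t - s) powr \<theta>"
      have D_eq: "D t - D s = integral {-2 * T..0} (\<lambda>r. (deriv K (t - r) - deriv K (s - r)) * W r \<omega>)"
        using elim(2) that by (auto simp: D_def)
      have "\<bar>D t - D s\<bar> \<le> c * enn2real (?A \<omega>)"
        unfolding D_eq
      proof (rule abs_integral_le_weighted)
        have *: "continuous_on {-2 * T..0} (\<lambda>r. deriv K (v - r))" if "v > 0" for v
          using continuous_on_modified_kernel_deriv[OF K that, of 1]
          by (auto intro: continuous_on_subset)
        show "continuous_on {-2 * T..0} (\<lambda>r. (deriv K (t - r) - deriv K (s - r)) * W r \<omega>)"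
          using st elim(5) by (intro continuous_intros *) (auto intro: continuous_on_subset)
        show "\<bar>deriv K (t - r) - deriv K (s - r)\<bar> \<le> c * \<bar>r\<bar> powr q"
          if "r \<in> {-2 * T..0}" "r \<noteq> 0" for r
          using kernel[of s t "- r"] st that by (simp add: c_def mult_ac)
        show "c \<ge> 0" using C(1) \<theta>(1) by (simp add: c_def)
        show "(\<lambda>r. W r \<omega>) \<in> borel_measurable borel"
          by (rule borel_measurable_continuous_onI) (rule elim(5))
        show "?A \<omega> < \<infinity>" by (rule elim(1))
      qed
      then show ?thesis by (simp add: B_def c_def mult_ac)
    qed
    have contD: "continuous_on {0<..T} D"
      unfolding D_def using elim(3,4)
      by (intro continuous_on_diff) (auto intro: continuous_on_subset)
    have "\<bar>D t - D s\<bar> \<le> B * s powr (\<eta> - \<theta>) * (t - s) powr \<theta>"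
      if "0 < s" "s < t" "t \<le> T" for s t
      using continuous_extension_of_bound[OF contD rational that] by blast
    with \<open>B \<ge> 0\<close> show ?case by (auto simp: D_def)
  qed
qed

end

theorem proposition6p2:
  fixes M :: "'a measure"
    and W WH What :: "real \<Rightarrow> 'a \<Rightarrow> real"
    and Khat :: "real \<Rightarrow> real"
    and H T \<gamma> \<eta> :: real
  assumes "two_sided_brownian_motion M W"
    and "1/4 < H" and "H < 1/2"
    and "T > 0"
    and "0 < \<gamma>" and "\<gamma> < 1" and "\<gamma> + H < 1"
    and "modified_kernel H T Khat"
    and "rl_process M W H WH"
    and "stationary_process M W Khat What"
    and "\<eta> < H"
  shows "AE \<omega> in M.
      ((\<lambda>t. WH t \<omega>), (\<lambda>t. 1)) \<in> singular_controlled_paths (\<lambda>t. What t \<omega>) \<gamma> H \<eta> T \<and>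
      (SUP (s, t) \<in> {(s, t). 0 < s \<and> s < t \<and> t \<le> T}.
         ennreal (\<bar>WH t \<omega> - WH s \<omega> - (What t \<omega> - What s \<omega>)\<bar> /
           (s powr (\<eta> - (\<gamma> + H)) * \<bar>t - s\<bar> powr (\<gamma> + H)))) < \<infinity>"
proof -
  \<comment> \<open>Smaller exponents give weaker estimates on bounded intervals, at the price of a power of \<open>T\<close>;
    raising \<open>\<eta>\<close> keeps the exponent \<open>H - \<eta> - 3/2\<close> of the weight nonpositive.\<close>
  define \<eta>' where "\<eta>' = max \<eta> 0"
  have \<eta>': "\<eta> \<le> \<eta>'" "\<eta>' < H" "0 \<le> \<eta>'" using assms by (auto simp: \<eta>'_def)
  have "AE \<omega> in M. \<exists>B\<ge>0. \<forall>s t. 0 < s \<longrightarrow> s < t \<longrightarrow> t \<le> T \<longrightarrow>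
     \<bar>(What t \<omega> - WH t \<omega>) - (What s \<omega> - WH s \<omega>)\<bar>
       \<le> B * s powr (\<eta>' - (\<gamma> + H)) * (t - s) powr (\<gamma> + H)"
    using assms \<eta>' by (intro two_sided_brownian_motion.remainder_bound_AE[of M W T H Khat]) auto
  then show ?thesis
  proof eventually_elim
    case (elim \<omega>)
    then obtain B where B: "B \<ge> 0" "\<And>s t. 0 < s \<Longrightarrow> s < t \<Longrightarrow> t \<le> T \<Longrightarrow>
      \<bar>(What t \<omega> - WH t \<omega>) - (What s \<omega> - WH s \<omega>)\<bar>
        \<le> B * s powr (\<eta>' - (\<gamma> + H)) * (t - s) powr (\<gamma> + H)" by blast
    have ratio: "\<bar>WH t \<omega> - WH s \<omega> - (What t \<omega> - What s \<omega>)\<bar> /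
        (s powr (\<eta> - (\<gamma> + H)) * \<bar>t - s\<bar> powr (\<gamma> + H)) \<le> B * T powr (\<eta>' - \<eta>)"
      if st: "0 < s" "s < t" "t \<le> T" for s t
    proof -
      have "\<bar>WH t \<omega> - WH s \<omega> - (What t \<omega> - What s \<omega>)\<bar> =
          \<bar>(What t \<omega> - WH t \<omega>) - (What s \<omega> - WH s \<omega>)\<bar>" by linarith
      also have "\<dots> \<le> B * s powr (\<eta>' - (\<gamma> + H)) * (t - s) powr (\<gamma> + H)"
        by (rule B(2)[OF st])
      also have "s powr (\<eta>' - (\<gamma> + H)) = s powr (\<eta>' - \<eta>) * s powr (\<eta> - (\<gamma> + H))"
      proof -
        have "\<eta>' - (\<gamma> + H) = (\<eta>' - \<eta>) + (\<eta> - (\<gamma> + H))" by simp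
        then show ?thesis by (simp only: powr_add)
      qed
      also have "B * (s powr (\<eta>' - \<eta>) * s powr (\<eta> - (\<gamma> + H))) * (t - s) powr (\<gamma> + H)
          \<le> B * (T powr (\<eta>' - \<eta>) * s powr (\<eta> - (\<gamma> + H))) * (t - s) powr (\<gamma> + H)"
        using st \<eta>' B(1) by (intro mult_left_mono mult_right_mono powr_mono2) auto
      finally show ?thesis
        using st by (simp add: divide_le_eq mult_ac)
    qed
    have sup: "(SUP (s, t) \<in> {(s, t). 0 < s \<and> s < t \<and> t \<le> T}.
         ennreal (\<bar>WH t \<omega> - WH s \<omega> - (What t \<omega> - What s \<omega>)\<bar> /
           (s powr (\<eta> - (\<gamma> + H)) * \<bar>t - s\<bar> powr (\<gamma> + H)))) < \<infinity>" (is "?S < _")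
    proof -
      have "?S \<le> ennreal (B * T powr (\<eta>' - \<eta>))"
        by (rule SUP_least) (auto intro!: ennreal_leI ratio)
      also have "\<dots> < \<infinity>" by simp
      finally show ?thesis .
    qed
    moreover have "(SUP (s, t) \<in> {(s, t). 0 < s \<and> s < t \<and> t \<le> T}.
        ennreal (\<bar>(1::real) - 1\<bar> / (s powr (\<eta> - (\<gamma> + H)) * \<bar>t - s\<bar> powr \<gamma>))) \<le> 0"
      by (rule SUP_least) auto
    ultimately show ?case
      by (auto simp: singular_controlled_paths_def rough_remainder_def)
  qed
qed

end
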